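(* Let $W$ be the complex Lie algebra with basis $\{L_m, I_m \mid m\in\mathbb{Z}\}$ and bracket $[L_m,L_n]=(m-n)L_{m+n}$, $[L_m,I_n]=(m-n)I_{m+n}$, $[I_m,I_n]=0$ for all $m,n\in\mathbb{Z}$. Then the automorphism group of $W$ satisfies $$Aut(W)\cong\mathbb{C}^{\infty}\rtimes(\mathbb{Z}_2\ltimes(\mathbb{C}^*\times\mathbb{C}^* )),$$ where $\mathbb{C}^\infty=\{(a_i)_{i\in\mathbb{Z}}\mid a_i\in\mathbb{C},\ \text{all but finitely many } a_i \text{ are zero}\}$ is regarded as an abelian group under addition.
   Context: In the semidirect products the normal factors are $\mathbb{C}^\infty$ (in the whole group) and $\mathbb{C}^*\times\mathbb{C}^*$ (in $\mathbb{Z}_2\ltimes(\mathbb{C}^*\times\mathbb{C}^* )$). The actions are those given by conjugation inside $Aut(W)$, under identifications of the factors with the following subgroups. For $\epsilon\in\{\pm1\}$, $\lambda\in\mathbb{C}$, $a,\mu\in\mathbb{C}^*$, let $\bar\sigma(\epsilon,\lambda,a,\mu)$ be the automorphism of $W$ with $L_n\mapsto a^n\epsilon L_{\epsilon n}+a^n\lambda nI_{\epsilon n}$, $I_n\mapsto a^n\mu I_{\epsilon n}$. Then: - $\mathbb{Z}_2=\{\pm1\}$ corresponds to $\mathfrak a=\{\bar\sigma(\epsilon,0,1,1)\mid\epsilon=\pm1\}$; - $\mathbb{C}^*\times\mathbb{C}^*$ corresponds to $\mathfrak b=\{\bar\sigma(1,0,a,\mu)\mid a,\mu\in\mathbb{C}^*\}$;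 - $\mathbb{C}^\infty$ corresponds to $\mathfrak Z\mathfrak t$, where $\mathfrak t=\{\bar\sigma(1,\lambda,1,1)\mid\lambda\in\mathbb{C}\}$ and $\mathfrak Z$ is the subgroup of $Aut(W)$ generated by all $\exp(k\,\mathrm{ad}\,I_m)$, $k\in\mathbb{C}$, $m\in\mathbb{Z}$. *)

theory Defs
  imports Complex_Main
    "HOL-Library.Poly_Mapping"
    "HOL-Algebra.Bij"
    "HOL-Algebra.Coset"
    "HOL-Algebra.Generated_Groups"
begin

section \<open>Complex Lie algebras and their automorphism groups\<close>

locale complex_lie_algebra = vector_space scale
  for scale :: "complex \<Rightarrow> 'a::ab_group_add \<Rightarrow> 'a" +
  fixes bracket :: "'a \<Rightarrow> 'a \<Rightarrow> 'a"
  assumes bracket_linear_left: "Vector_Spaces.linear scale scale (\<lambda>x. bracket x y)"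
    and bracket_linear_right: "Vector_Spaces.linear scale scale (\<lambda>y. bracket x y)"
    and bracket_self: "bracket x x = 0"
    and jacobi: "bracket x (bracket y z) + bracket y (bracket z x) + bracket z (bracket x y) = 0"

definition lie_Aut ::
  "(complex \<Rightarrow> 'a::ab_group_add \<Rightarrow> 'a) \<Rightarrow> ('a \<Rightarrow> 'a \<Rightarrow> 'a) \<Rightarrow> ('a \<Rightarrow> 'a) monoid"
  where "lie_Aut scale bracket =
    \<lparr>carrier = {f. Vector_Spaces.linear scale scale f \<and> bij f \<and>
                   (\<forall>x y. f (bracket x y) = bracket (f x) (f y))},
     mult = (\<circ>),
     one = id\<rparr>"

text \<open>The exponential of a locally nilpotent linear operator \<open>f\<close>: for each \<open>x\<close> only the
  finitely many nonzero terms of \<open>\<Sum>i. f\<^sup>i x / i!\<close> are summed.\<close>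

definition lie_exp :: "(complex \<Rightarrow> 'a::ab_group_add \<Rightarrow> 'a) \<Rightarrow> ('a \<Rightarrow> 'a) \<Rightarrow> 'a \<Rightarrow> 'a"
  where "lie_exp scale f x = (\<Sum>i | (f ^^ i) x \<noteq> 0. scale (1 / fact i) ((f ^^ i) x))"

lemma (in complex_lie_algebra) lie_Aut_group: "group (lie_Aut scale bracket)"
proof (rule groupI)
  fix f assume "f \<in> carrier (lie_Aut scale bracket)"
  hence lf: "Vector_Spaces.linear scale scale f" and bf: "bij f"
    and hf: "\<And>x y. f (bracket x y) = bracket (f x) (f y)"
    by (auto simp: lie_Aut_def)
  have fi: "f (inv_into UNIV f x) = x" for x
    using bf by (simp add: bij_is_surj surj_f_inv_f)
  have if': "inv_into UNIV f (f x) = x" for x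
    using bf by (simp add: bij_is_inj)
  have "Vector_Spaces.linear scale scale (inv_into UNIV f)"
    by (rule linear_iff_module_hom[THEN iffD2], unfold_locales)
       (metis fi if' module_hom.add[OF lf[unfolded linear_iff_module_hom]]
        module_hom.scale[OF lf[unfolded linear_iff_module_hom]])+
  moreover have "bij (inv_into UNIV f)"
    using bf by (rule bij_imp_bij_inv)
  moreover have "inv_into UNIV f (bracket x y) =
      bracket (inv_into UNIV f x) (inv_into UNIV f y)" for x y
    by (metis fi hf if')
  moreover have "inv_into UNIV f \<circ> f = id"
    using if' by auto
  ultimately show "\<exists>g\<in>carrier (lie_Aut scale bracket).
      g \<otimes>\<^bsub>lie_Aut scale bracket\<^esub> f = \<one>\<^bsub>lie_Aut scale bracket\<^esub>"
    by (auto simp: lie_Aut_def)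
qed (auto simp: lie_Aut_def bij_comp bij_id[unfolded id_def] linear_id[unfolded id_def] id_def comp_assoc
      intro: Vector_Spaces.linear_compose)


section \<open>The Lie algebra \<open>W\<close>\<close>

datatype W_index = LI int | II int

type_synonym W = "W_index \<Rightarrow>\<^sub>0 complex"

definition W_scale :: "complex \<Rightarrow> W \<Rightarrow> W"
  where "W_scale c = Poly_Mapping.map ((*) c)"

definition Lw :: "int \<Rightarrow> W"
  where "Lw m = Poly_Mapping.single (LI m) 1"

definition Iw :: "int \<Rightarrow> W"
  where "Iw m = Poly_Mapping.single (II m) 1"

text \<open>The linear map with prescribed values on the basis.\<close>

definition W_lin_ext :: "(W_index \<Rightarrow> W) \<Rightarrow> W \<Rightarrow> W"
  where "W_lin_ext g x =
    (\<Sum>b\<in>Poly_Mapping.keys x. W_scale (Poly_Mapping.lookup x b) (g b))"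

fun W_basis_bracket :: "W_index \<Rightarrow> W_index \<Rightarrow> W"
  where
    "W_basis_bracket (LI m) (LI n) = W_scale (of_int (m - n)) (Lw (m + n))"
  | "W_basis_bracket (LI m) (II n) = W_scale (of_int (m - n)) (Iw (m + n))"
  | "W_basis_bracket (II m) (LI n) = - W_scale (of_int (n - m)) (Iw (n + m))"
  | "W_basis_bracket (II m) (II n) = 0"

definition W_bracket :: "W \<Rightarrow> W \<Rightarrow> W"
  where "W_bracket x y = W_lin_ext (\<lambda>b. W_lin_ext (W_basis_bracket b) y) x"

lemma lookup_W_scale [simp]:
  "Poly_Mapping.lookup (W_scale c x) b = c * Poly_Mapping.lookup x b"
  unfolding W_scale_def by transfer (auto simp: when_def)

interpretation W: vector_space W_scale
  by unfold_locales (auto intro!: poly_mapping_eqI simp: lookup_add algebra_simps)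

lemma W_lin_ext_superset:
  assumes "finite A" "Poly_Mapping.keys x \<subseteq> A"
  shows "W_lin_ext g x = (\<Sum>b\<in>A. W_scale (Poly_Mapping.lookup x b) (g b))"
  unfolding W_lin_ext_def using assms
  by (intro sum.mono_neutral_left) (auto simp: in_keys_iff)

lemma W_lin_ext_linear: "Vector_Spaces.linear W_scale W_scale (W_lin_ext g)"
proof (rule linear_iff_module_hom[THEN iffD2], unfold_locales)
  fix x y :: W and c :: complex
  let ?A = "Poly_Mapping.keys x \<union> Poly_Mapping.keys y"
  have "Poly_Mapping.keys (x + y) \<subseteq> ?A" by (rule keys_add)
  then show "W_lin_ext g (x + y) = W_lin_ext g x + W_lin_ext g y"
    by (simp add: W_lin_ext_superset[of ?A] lookup_add W.scale_left_distrib sum.distrib)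
  have "Poly_Mapping.keys (W_scale c x) \<subseteq> Poly_Mapping.keys x"
    by (auto simp: in_keys_iff)
  then show "W_lin_ext g (W_scale c x) = W_scale c (W_lin_ext g x)"
    by (simp add: W_lin_ext_superset[of "Poly_Mapping.keys x"] W.scale_sum_right)
qed

lemma W_lin_ext_single [simp]: "W_lin_ext g (Poly_Mapping.single b 1) = g b"
  by (simp add: W_lin_ext_def)

lemma W_expand: "x = W_lin_ext (\<lambda>b. Poly_Mapping.single b 1) x"
proof (rule poly_mapping_eqI)
  fix k
  have "Poly_Mapping.lookup (W_lin_ext (\<lambda>b. Poly_Mapping.single b 1) x) k
      = (\<Sum>b\<in>Poly_Mapping.keys x. if b = k then Poly_Mapping.lookup x k else 0)"
    unfolding W_lin_ext_def lookup_sum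
    by (intro sum.cong) (auto simp: lookup_single when_def)
  then show "Poly_Mapping.lookup x k
      = Poly_Mapping.lookup (W_lin_ext (\<lambda>b. Poly_Mapping.single b 1) x) k"
    by (simp add: in_keys_iff)
qed

lemma W_linear_eqI:
  assumes f: "Vector_Spaces.linear W_scale W_scale f"
    and g: "Vector_Spaces.linear W_scale W_scale g"
    and eq: "\<And>b. f (Poly_Mapping.single b 1) = g (Poly_Mapping.single b 1)"
  shows "f x = g x"
proof -
  have *: "h x = W_lin_ext (\<lambda>b. h (Poly_Mapping.single b 1)) x"
    if h: "Vector_Spaces.linear W_scale W_scale h" for h
  proof -
    interpret h: Vector_Spaces.linear W_scale W_scale h by (fact h)
    show ?thesis
      by (subst W_expand) (simp add: W_lin_ext_def h.sum h.scale)
  qed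
  show ?thesis using *[OF f] *[OF g] eq by simp
qed

lemma W_bracket_linear_left: "Vector_Spaces.linear W_scale W_scale (\<lambda>x. W_bracket x y)"
  unfolding W_bracket_def by (rule W_lin_ext_linear)

lemma W_bracket_linear_right: "Vector_Spaces.linear W_scale W_scale (\<lambda>y. W_bracket x y)"
proof (rule linear_iff_module_hom[THEN iffD2], unfold_locales)
  fix y z :: W and c :: complex
  show "W_bracket x (y + z) = W_bracket x y + W_bracket x z"
    by (simp add: W_bracket_def W_lin_ext_def[of _ x] W.scale_right_distrib sum.distrib
        module_hom.add[OF W_lin_ext_linear[unfolded linear_iff_module_hom]])
  show "W_bracket x (W_scale c y) = W_scale c (W_bracket x y)"
    by (simp add: W_bracket_def W_lin_ext_def[of _ x] W.scale_sum_right mult.commute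
        module_hom.scale[OF W_lin_ext_linear[unfolded linear_iff_module_hom]])
qed

lemma W_bracket_single:
  "W_bracket (Poly_Mapping.single b 1) (Poly_Mapping.single c 1) = W_basis_bracket b c"
  by (simp add: W_bracket_def)

lemma W_bracket_basis:
  "W_bracket (Lw m) (Lw n) = W_scale (of_int (m - n)) (Lw (m + n))"
  "W_bracket (Lw m) (Iw n) = W_scale (of_int (m - n)) (Iw (m + n))"
  "W_bracket (Iw m) (Iw n) = 0"
  by (simp_all add: Lw_def Iw_def W_bracket_single)

lemma W_basis:
  "inj Lw" "inj Iw" "range Lw \<inter> range Iw = {}"
  "W.independent (range Lw \<union> range Iw)" "W.span (range Lw \<union> range Iw) = UNIV"
proof -
  let ?e = "\<lambda>b. Poly_Mapping.single b (1::complex)"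
  have inj_e: "inj ?e"
    by (auto simp: inj_def dest!: arg_cong[where f = Poly_Mapping.keys])
  show "inj Lw" "inj Iw" "range Lw \<inter> range Iw = {}"
    by (auto simp: Lw_def Iw_def inj_def dest!: injD[OF inj_e])
  have rng: "range Lw \<union> range Iw = range ?e"
    unfolding Lw_def Iw_def
    by (auto simp: image_iff) (metis W_index.exhaust)
  show "W.span (range Lw \<union> range Iw) = UNIV"
  proof -
    have "x \<in> W.span (range ?e)" for x
      by (subst W_expand) (unfold W_lin_ext_def,
          intro W.span_sum W.span_scale W.span_base rangeI)
    then show ?thesis unfolding rng by auto
  qed
  show "W.independent (range Lw \<union> range Iw)"
    unfolding rng W.dependent_explicit
  proof (clarify)
    fix t u v
    assume t: "finite t" "t \<subseteq> range ?e" and s0: "(\<Sum>w\<in>t. W_scale (u w) w) = 0"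
      and v: "v \<in> t" "u v \<noteq> 0"
    from v t obtain b where b: "v = ?e b" by auto
    have "0 = (\<Sum>w\<in>t. u w * Poly_Mapping.lookup w b)"
      using arg_cong[OF s0, of "\<lambda>x. Poly_Mapping.lookup x b"] by (simp add: lookup_sum)
    also have "\<dots> = (\<Sum>w\<in>t. if w = v then u v else 0)"
    proof (rule sum.cong[OF refl])
      fix w assume "w \<in> t"
      then obtain c where c: "w = ?e c" using t by auto
      show "u w * Poly_Mapping.lookup w b = (if w = v then u v else 0)"
        unfolding c b using injD[OF inj_e, of c b] by (auto simp: lookup_single when_def)
    qed
    also have "\<dots> = u v" using t v by simp
    finally show False using v by simp
  qed
qed

lemma W_bracket_simps:
  "W_bracket (x + y) z = W_bracket x z + W_bracket y z"
  "W_bracket x (y + z) = W_bracket x y + W_bracket x z"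
  "W_bracket (W_scale c x) y = W_scale c (W_bracket x y)"
  "W_bracket x (W_scale c y) = W_scale c (W_bracket x y)"
  using W_bracket_linear_left W_bracket_linear_right
  by (simp_all add: linear_iff_module_hom module_hom_iff)

lemma W_bracket_minus_right: "W_bracket x (- y) = - W_bracket x y"
  using W_bracket_simps(4)[of x "-1" y] by simp

lemma W_bracket_0_right: "W_bracket x 0 = 0"
  using W_bracket_simps(4)[of x 0 0] by simp

lemma W_linearI:
  assumes "\<And>x y. f (x + y) = f x + f y" "\<And>c x. f (W_scale c x) = W_scale c (f x)"
  shows "Vector_Spaces.linear W_scale W_scale f"
  by (rule linear_iff_module_hom[THEN iffD2], unfold_locales) (fact assms)+

lemma W_bracket_antisym: "W_bracket x y = - W_bracket y x"
proof (rule W_linear_eqI[of "\<lambda>x. W_bracket x y" "\<lambda>x. - W_bracket y x"])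
  fix b
  show "W_bracket (Poly_Mapping.single b 1) y = - W_bracket y (Poly_Mapping.single b 1)"
  proof (rule W_linear_eqI[of "\<lambda>y. W_bracket (Poly_Mapping.single b 1) y"
        "\<lambda>y. - W_bracket y (Poly_Mapping.single b 1)"])
    fix c
    show "W_bracket (Poly_Mapping.single b 1) (Poly_Mapping.single c 1)
        = - W_bracket (Poly_Mapping.single c 1) (Poly_Mapping.single b 1)"
      by (cases b; cases c)
         (auto intro!: poly_mapping_eqI
           simp: W_bracket_single Lw_def Iw_def lookup_single when_def add.commute)
  qed (auto intro!: W_linearI simp: W_bracket_simps)
qed (auto intro!: W_linearI simp: W_bracket_simps)

lemma W_jacobi:
  "W_bracket x (W_bracket y z) + W_bracket y (W_bracket z x) + W_bracket z (W_bracket x y) = 0"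
proof -
  let ?e = "\<lambda>b. Poly_Mapping.single b (1::complex)"
  define J where "J = (\<lambda>x y z. W_bracket x (W_bracket y z) + W_bracket y (W_bracket z x)
    + W_bracket z (W_bracket x y))"
  have lin0: "Vector_Spaces.linear W_scale W_scale (\<lambda>_. 0)"
    by (rule W_linearI) auto
  have l1: "Vector_Spaces.linear W_scale W_scale (\<lambda>x. J x y z)" for y z
    by (rule W_linearI) (auto simp: J_def W_bracket_simps W.scale_right_distrib)
  have l2: "Vector_Spaces.linear W_scale W_scale (\<lambda>y. J x y z)" for x z
    by (rule W_linearI) (auto simp: J_def W_bracket_simps W.scale_right_distrib)
  have l3: "Vector_Spaces.linear W_scale W_scale (\<lambda>z. J x y z)" for x y
    by (rule W_linearI) (auto simp: J_def W_bracket_simps W.scale_right_distrib)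
  have eI: "?e (LI n) = Lw n" "?e (II n) = Iw n" for n by (simp_all add: Lw_def Iw_def)
  have IL: "W_bracket (Iw m) (Lw n) = - W_scale (of_int (n - m)) (Iw (n + m))" for m n
    by (simp add: Lw_def Iw_def W_bracket_single)
  have J0: "J (?e a) (?e b) (?e c) = 0" for a b c
    by (cases a; cases b; cases c)
       (auto intro!: poly_mapping_eqI simp: J_def eI W_bracket_basis IL W_bracket_simps
         W_bracket_minus_right W_bracket_0_right lookup_add lookup_minus,
        auto simp: Lw_def Iw_def lookup_single when_def lookup_add lookup_minus algebra_simps)
  have "J x y z = 0"
    by (rule W_linear_eqI[OF l1 lin0], rule W_linear_eqI[OF l2 lin0],
        rule W_linear_eqI[OF l3 lin0], rule J0)
  then show ?thesis by (simp add: J_def)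
qed

interpretation W: complex_lie_algebra W_scale W_bracket
proof unfold_locales
  fix x
  have "W_scale 2 (W_bracket x x) = W_bracket x x + W_bracket x x"
    using W.scale_left_distrib[of 1 1 "W_bracket x x"] by simp
  also have "\<dots> = 0" using W_bracket_antisym[of x x] by (simp add: eq_neg_iff_add_eq_0)
  finally show "W_bracket x x = 0" by (simp add: W.scale_eq_0_iff)
qed (rule W_bracket_simps W_jacobi)+


section \<open>Semidirect products and the factors\<close>

text \<open>The group \<open>N \<rtimes> H\<close>, also written \<open>H \<ltimes> N\<close>, where \<open>H\<close> acts on \<open>N\<close> through \<open>\<theta>\<close>; the normal
  factor is always the first component.\<close>

definition semidirect ::
  "'n monoid \<Rightarrow> 'h monoid \<Rightarrow> ('h \<Rightarrow> 'n \<Rightarrow> 'n) \<Rightarrow> ('n \<times> 'h) monoid"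
  where "semidirect N H \<theta> =
    \<lparr>carrier = carrier N \<times> carrier H,
     mult = (\<lambda>(n, h) (n', h'). (n \<otimes>\<^bsub>N\<^esub> \<theta> h n', h \<otimes>\<^bsub>H\<^esub> h')),
     one = (\<one>\<^bsub>N\<^esub>, \<one>\<^bsub>H\<^esub>)\<rparr>"

text \<open>The action of \<open>H\<close> on \<open>N\<close> given by conjugation in \<open>G\<close>, when \<open>N\<close> and \<open>H\<close> are identified
  with subgroups of \<open>G\<close> through \<open>i\<close> and \<open>j\<close>. The image of \<open>N\<close> has to be normalized by that of
  \<open>H\<close>.\<close>

definition conj_action ::
  "'g monoid \<Rightarrow> 'n monoid \<Rightarrow> ('n \<Rightarrow> 'g) \<Rightarrow> ('h \<Rightarrow> 'g) \<Rightarrow> 'h \<Rightarrow> 'n \<Rightarrow> 'n"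
  where "conj_action G N i j h =
    (\<lambda>n\<in>carrier N. inv_into (carrier N) i (j h \<otimes>\<^bsub>G\<^esub> i n \<otimes>\<^bsub>G\<^esub> inv\<^bsub>G\<^esub> (j h)))"

definition Z2 :: "int monoid"
  where "Z2 = \<lparr>carrier = {1, -1}, mult = (*), one = 1\<rparr>"

definition Cstar :: "complex monoid"
  where "Cstar = \<lparr>carrier = - {0}, mult = (*), one = 1\<rparr>"

definition Cinf :: "(int \<Rightarrow>\<^sub>0 complex) monoid"
  where "Cinf = \<lparr>carrier = UNIV, mult = (+), one = 0\<rparr>"


section \<open>Subgroups of the automorphism group of \<open>W\<close>\<close>

definition Aut_W :: "(W \<Rightarrow> W) monoid"
  where "Aut_W = lie_Aut W_scale W_bracket"

definition sigma_bar :: "int \<Rightarrow> complex \<Rightarrow> complex \<Rightarrow> complex \<Rightarrow> W \<Rightarrow> W"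
  where "sigma_bar \<epsilon> l a \<mu> = W_lin_ext (\<lambda>b. case b of
      LI n \<Rightarrow> W_scale (a powi n * of_int \<epsilon>) (Lw (\<epsilon> * n))
            + W_scale (a powi n * l * of_int n) (Iw (\<epsilon> * n))
    | II n \<Rightarrow> W_scale (a powi n * \<mu>) (Iw (\<epsilon> * n)))"

lemma sigma_bar_basis:
  "sigma_bar \<epsilon> l a \<mu> (Lw n) =
     W_scale (a powi n * of_int \<epsilon>) (Lw (\<epsilon> * n)) + W_scale (a powi n * l * of_int n) (Iw (\<epsilon> * n))"
  "sigma_bar \<epsilon> l a \<mu> (Iw n) = W_scale (a powi n * \<mu>) (Iw (\<epsilon> * n))"
  by (simp_all add: sigma_bar_def Lw_def[of n] Iw_def[of n])

lemma sigma_bar_linear: "Vector_Spaces.linear W_scale W_scale (sigma_bar \<epsilon> l a \<mu>)"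
  unfolding sigma_bar_def by (rule W_lin_ext_linear)

lemma Aut_W_group: "group Aut_W"
  unfolding Aut_W_def by (rule W.lie_Aut_group)

definition sub_a :: "(W \<Rightarrow> W) set"
  where "sub_a = {sigma_bar \<epsilon> 0 1 1 | \<epsilon>. \<epsilon> \<in> {1, -1}}"

definition sub_b :: "(W \<Rightarrow> W) set"
  where "sub_b = {sigma_bar 1 0 a \<mu> | a \<mu>. a \<noteq> 0 \<and> \<mu> \<noteq> 0}"

definition sub_t :: "(W \<Rightarrow> W) set"
  where "sub_t = {sigma_bar 1 l 1 1 | l. True}"

definition sub_Z :: "(W \<Rightarrow> W) set"
  where "sub_Z = generate Aut_W
    {lie_exp W_scale (\<lambda>x. W_scale k (W_bracket (Iw m) x)) | k m. True}"

definition sub_Zt :: "(W \<Rightarrow> W) set"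
  where "sub_Zt = sub_Z <#>\<^bsub>Aut_W\<^esub> sub_t"

definition emb_Z2 :: "int \<Rightarrow> W \<Rightarrow> W"
  where "emb_Z2 \<epsilon> = sigma_bar \<epsilon> 0 1 1"

definition emb_CC :: "complex \<times> complex \<Rightarrow> W \<Rightarrow> W"
  where "emb_CC = (\<lambda>(a, \<mu>). sigma_bar 1 0 a \<mu>)"

text \<open>The identification of \<open>\<complex>\<^sup>\<infinity>\<close> with \<open>\<ZZ>\<tt>\<close>. The operators \<open>ad I\<^sub>m\<close> commute, so
  \<open>exp (ad (\<Sum>m. c\<^sub>m I\<^sub>m))\<close> is the product of the \<open>exp (c\<^sub>m ad I\<^sub>m)\<close>. No separate parameter for
  \<open>\<tt>\<close> is needed, since \<open>\<sigma>(1,\<lambda>,1,1) = exp (-\<lambda> ad I\<^sub>0)\<close>.\<close>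

definition emb_Cinf :: "(int \<Rightarrow>\<^sub>0 complex) \<Rightarrow> W \<Rightarrow> W"
  where "emb_Cinf c = lie_exp W_scale
    (W_bracket (\<Sum>m\<in>Poly_Mapping.keys c. W_scale (Poly_Mapping.lookup c m) (Iw m)))"

definition act_Z2_CC :: "int \<Rightarrow> complex \<times> complex \<Rightarrow> complex \<times> complex"
  where "act_Z2_CC = conj_action Aut_W (Cstar \<times>\<times> Cstar) emb_CC emb_Z2"

definition Z2_CC :: "((complex \<times> complex) \<times> int) monoid"
  where "Z2_CC = semidirect (Cstar \<times>\<times> Cstar) Z2 act_Z2_CC"

definition emb_Z2_CC :: "(complex \<times> complex) \<times> int \<Rightarrow> W \<Rightarrow> W"
  where "emb_Z2_CC = (\<lambda>(x, \<epsilon>). emb_CC x \<otimes>\<^bsub>Aut_W\<^esub> emb_Z2 \<epsilon>)"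

definition act_Cinf ::
  "(complex \<times> complex) \<times> int \<Rightarrow> (int \<Rightarrow>\<^sub>0 complex) \<Rightarrow> (int \<Rightarrow>\<^sub>0 complex)"
  where "act_Cinf = conj_action Aut_W Cinf emb_Cinf emb_Z2_CC"

end

theory Submission
  imports Defs
begin

text \<open>
  An element lies in the ideal \<open>span {I\<^sub>n}\<close> iff its adjoint action squares to zero (compare top-degree
  coefficients), so every automorphism \<open>f\<close> preserves this ideal. Modulo the ideal, a top-degree
  argument for the eigenvector equations \<open>[f L\<^sub>0, f L\<^sub>n] = -n f L\<^sub>n\<close> forces \<open>f L\<^sub>0 = \<epsilon> L\<^sub>0\<close> with
  \<open>\<epsilon> = \<plusminus>1\<close>, hence \<open>f L\<^sub>n = \<epsilon> a\<^sup>n L\<close> with index \<open>\<epsilon> n\<close>. After dividing by the corresponding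
  \<open>\<sigma>(\<epsilon>,0,a,\<mu>)\<close>, the automorphism fixes every \<open>I\<^sub>n\<close> and moves \<open>L\<^sub>n\<close> by a derivation into the ideal;
  such derivations are inner, so what remains is \<open>exp (ad v)\<close> with \<open>v\<close> in the ideal.
\<close>

section \<open>Semidirect products inside a group\<close>

text \<open>Instantiated twice: for \<open>Z2\<close> acting on
  \<open>Cstar \<times>\<times> Cstar\<close>, and then for that product acting on
  \<open>Cinf\<close>. The condition \<open>normalizes\<close> is phrased without inverses, so that
  in \<open>Aut_W\<close> it becomes an equation between compositions.\<close>

locale semidirect_embedding =
  N: group N + H: group H + G: group G
  for N :: "'n monoid" and H :: "'h monoid" and G :: "'g monoid" +
  fixes i :: "'n \<Rightarrow> 'g" and j :: "'h \<Rightarrow> 'g"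
  assumes i_hom: "i \<in> hom N G" and i_inj: "inj_on i (carrier N)"
    and j_hom: "j \<in> hom H G"
    and normalizes: "\<lbrakk>h \<in> carrier H; n \<in> carrier N\<rbrakk> \<Longrightarrow>
      \<exists>d\<in>carrier N. j h \<otimes>\<^bsub>G\<^esub> i n = i d \<otimes>\<^bsub>G\<^esub> j h"
begin

abbreviation act :: "'h \<Rightarrow> 'n \<Rightarrow> 'n"
  where "act \<equiv> conj_action G N i j"

abbreviation prod_emb :: "'n \<times> 'h \<Rightarrow> 'g"
  where "prod_emb \<equiv> (\<lambda>(n, h). i n \<otimes>\<^bsub>G\<^esub> j h)"

lemma i_closed [simp]: "n \<in> carrier N \<Longrightarrow> i n \<in> carrier G"
  using i_hom by (rule hom_in_carrier)

lemma j_closed [simp]: "h \<in> carrier H \<Longrightarrow> j h \<in> carrier G"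
  using j_hom by (rule hom_in_carrier)

lemma i_mult: "\<lbrakk>m \<in> carrier N; n \<in> carrier N\<rbrakk> \<Longrightarrow> i (m \<otimes>\<^bsub>N\<^esub> n) = i m \<otimes>\<^bsub>G\<^esub> i n"
  using i_hom by (rule hom_mult)

lemma j_mult: "\<lbrakk>g \<in> carrier H; h \<in> carrier H\<rbrakk> \<Longrightarrow> j (g \<otimes>\<^bsub>H\<^esub> h) = j g \<otimes>\<^bsub>G\<^esub> j h"
  using j_hom by (rule hom_mult)

lemma i_one: "i \<one>\<^bsub>N\<^esub> = \<one>\<^bsub>G\<^esub>"
  by (rule hom_one[OF i_hom N.is_group G.is_group])

lemma j_one: "j \<one>\<^bsub>H\<^esub> = \<one>\<^bsub>G\<^esub>"
  by (rule hom_one[OF j_hom H.is_group G.is_group])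

lemma i_eqD: "\<lbrakk>i m = i n; m \<in> carrier N; n \<in> carrier N\<rbrakk> \<Longrightarrow> m = n"
  using i_inj by (auto dest: inj_onD)

text \<open>Replaces \<open>inv_into\<close> and the group inverse in \<open>conj_action\<close> by
  a commutation relation; injectivity of \<open>i\<close> makes the element \<open>d\<close> unique.
  The laws of the action below are all checked in this form.\<close>

lemma act_eqI:
  assumes "h \<in> carrier H" "n \<in> carrier N" "d \<in> carrier N"
    and "j h \<otimes>\<^bsub>G\<^esub> i n = i d \<otimes>\<^bsub>G\<^esub> j h"
  shows "act h n = d"
proof -
  have "j h \<otimes>\<^bsub>G\<^esub> i n \<otimes>\<^bsub>G\<^esub> inv\<^bsub>G\<^esub> (j h) = i d"
    using assms by (simp add: G.m_assoc)
  then show ?thesis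
    using assms i_inj by (simp add: conj_action_def)
qed

lemma
  assumes "h \<in> carrier H" "n \<in> carrier N"
  shows act_closed [simp]: "act h n \<in> carrier N"
    and act_commute: "j h \<otimes>\<^bsub>G\<^esub> i n = i (act h n) \<otimes>\<^bsub>G\<^esub> j h"
proof -
  from normalizes[OF assms] obtain d
    where d: "d \<in> carrier N" "j h \<otimes>\<^bsub>G\<^esub> i n = i d \<otimes>\<^bsub>G\<^esub> j h" by blast
  moreover from act_eqI[OF assms d] have "act h n = d" .
  ultimately show "act h n \<in> carrier N"
    and "j h \<otimes>\<^bsub>G\<^esub> i n = i (act h n) \<otimes>\<^bsub>G\<^esub> j h" by simp_all
qed

lemma act_mult_right:
  assumes "h \<in> carrier H" "m \<in> carrier N" "n \<in> carrier N"
  shows "act h (m \<otimes>\<^bsub>N\<^esub> n) = act h m \<otimes>\<^bsub>N\<^esub> act h n"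
proof (rule act_eqI)
  have "j h \<otimes>\<^bsub>G\<^esub> i (m \<otimes>\<^bsub>N\<^esub> n) = (j h \<otimes>\<^bsub>G\<^esub> i m) \<otimes>\<^bsub>G\<^esub> i n"
    using assms by (simp add: i_mult G.m_assoc)
  also have "\<dots> = i (act h m) \<otimes>\<^bsub>G\<^esub> (j h \<otimes>\<^bsub>G\<^esub> i n)"
    using assms by (simp add: act_commute G.m_assoc)
  also have "\<dots> = i (act h m \<otimes>\<^bsub>N\<^esub> act h n) \<otimes>\<^bsub>G\<^esub> j h"
    using assms by (simp add: act_commute i_mult G.m_assoc)
  finally show "j h \<otimes>\<^bsub>G\<^esub> i (m \<otimes>\<^bsub>N\<^esub> n) = i (act h m \<otimes>\<^bsub>N\<^esub> act h n) \<otimes>\<^bsub>G\<^esub> j h" .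
qed (use assms in simp_all)

lemma act_mult_left:
  assumes "g \<in> carrier H" "h \<in> carrier H" "n \<in> carrier N"
  shows "act (g \<otimes>\<^bsub>H\<^esub> h) n = act g (act h n)"
proof (rule act_eqI)
  have "j (g \<otimes>\<^bsub>H\<^esub> h) \<otimes>\<^bsub>G\<^esub> i n = j g \<otimes>\<^bsub>G\<^esub> (j h \<otimes>\<^bsub>G\<^esub> i n)"
    using assms by (simp add: j_mult G.m_assoc)
  also have "\<dots> = (j g \<otimes>\<^bsub>G\<^esub> i (act h n)) \<otimes>\<^bsub>G\<^esub> j h"
    using assms by (simp add: act_commute[of h] G.m_assoc)
  also have "\<dots> = i (act g (act h n)) \<otimes>\<^bsub>G\<^esub> j (g \<otimes>\<^bsub>H\<^esub> h)"
    using assms by (simp add: act_commute[of g] j_mult G.m_assoc)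
  finally show "j (g \<otimes>\<^bsub>H\<^esub> h) \<otimes>\<^bsub>G\<^esub> i n = i (act g (act h n)) \<otimes>\<^bsub>G\<^esub> j (g \<otimes>\<^bsub>H\<^esub> h)" .
qed (use assms in simp_all)

lemma act_one: "n \<in> carrier N \<Longrightarrow> act \<one>\<^bsub>H\<^esub> n = n"
  by (rule act_eqI) (simp_all add: j_one)

lemma act_auto:
  assumes h: "h \<in> carrier H"
  shows "act h \<in> auto N"
proof -
  have "bij_betw (act h) (carrier N) (carrier N)"
    by (rule bij_betw_byWitness[where f' = "act (inv\<^bsub>H\<^esub> h)"])
      (use h in \<open>auto simp: act_mult_left[symmetric] act_one\<close>)
  \<comment> \<open>Membership in \<open>auto N\<close> asks for extensionality, which is why
    \<open>conj_action\<close> is a restricted function.\<close>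
  moreover have "act h \<in> extensional (carrier N)"
    by (simp add: conj_action_def)
  ultimately show ?thesis
    using h by (auto simp: auto_def Bij_def hom_def act_mult_right)
qed

lemma act_hom: "act \<in> hom H (AutoGroup N)"
proof (rule homI)
  fix g h assume gh: "g \<in> carrier H" "h \<in> carrier H"
  have "act (g \<otimes>\<^bsub>H\<^esub> h) = compose (carrier N) (act g) (act h)"
  \<comment> \<open>Outside \<open>carrier N\<close> both sides are
    \<open>undefined\<close>.\<close>
  proof
    fix n
    show "act (g \<otimes>\<^bsub>H\<^esub> h) n = compose (carrier N) (act g) (act h) n"
      using gh
      by (cases "n \<in> carrier N") (auto simp: act_mult_left compose_def, auto simp: conj_action_def)
  qed
  then show "act (g \<otimes>\<^bsub>H\<^esub> h) = act g \<otimes>\<^bsub>AutoGroup N\<^esub> act h"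
    using act_auto gh by (simp add: AutoGroup_def BijGroup_def auto_def)
qed (simp add: AutoGroup_def act_auto)

section \<open>The semidirect product and its map into the ambient group\<close>

lemma semidirect_group: "group (semidirect N H act)"
proof (rule groupI)
  fix x assume "x \<in> carrier (semidirect N H act)"
  then obtain n h where x: "x = (n, h)" "n \<in> carrier N" "h \<in> carrier H"
    by (auto simp: semidirect_def)
  \<comment> \<open>In the product of \<open>?y\<close> with \<open>x\<close>, the first component
    is the inverse of \<open>h\<close> acting on the product of the inverse of \<open>n\<close> with
    \<open>n\<close>, hence on the unit.\<close>
  let ?y = "(act (inv\<^bsub>H\<^esub> h) (inv\<^bsub>N\<^esub> n), inv\<^bsub>H\<^esub> h)"
  have "?y \<otimes>\<^bsub>semidirect N H act\<^esub> x = \<one>\<^bsub>semidirect N H act\<^esub>"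
    using x by (simp add: semidirect_def act_mult_right[symmetric])
      (auto intro!: act_eqI simp: i_one)
  then show "\<exists>y\<in>carrier (semidirect N H act).
      y \<otimes>\<^bsub>semidirect N H act\<^esub> x = \<one>\<^bsub>semidirect N H act\<^esub>"
    using x by (intro bexI[of _ ?y]) (auto simp: semidirect_def)
qed (auto simp: semidirect_def act_mult_right act_mult_left act_one N.m_assoc H.m_assoc)

text \<open>Moving \<open>j h\<close> past \<open>i n'\<close> produces exactly the twist
  \<open>act h n'\<close> of the semidirect multiplication.\<close>

lemma prod_emb_hom: "prod_emb \<in> hom (semidirect N H act) G"
proof (rule homI)
  fix x y assume "x \<in> carrier (semidirect N H act)" "y \<in> carrier (semidirect N H act)"
  then obtain n h n' h' where xy: "x = (n, h)" "y = (n', h')"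
    and c: "n \<in> carrier N" "h \<in> carrier H" "n' \<in> carrier N" "h' \<in> carrier H"
    by (auto simp: semidirect_def)
  have "i n \<otimes>\<^bsub>G\<^esub> j h \<otimes>\<^bsub>G\<^esub> (i n' \<otimes>\<^bsub>G\<^esub> j h') = i n \<otimes>\<^bsub>G\<^esub> (j h \<otimes>\<^bsub>G\<^esub> i n') \<otimes>\<^bsub>G\<^esub> j h'"
    using c by (simp add: G.m_assoc)
  also have "\<dots> = i (n \<otimes>\<^bsub>N\<^esub> act h n') \<otimes>\<^bsub>G\<^esub> j (h \<otimes>\<^bsub>H\<^esub> h')"
    using c by (simp add: act_commute i_mult j_mult G.m_assoc)
  finally show "prod_emb (x \<otimes>\<^bsub>semidirect N H act\<^esub> y) = prod_emb x \<otimes>\<^bsub>G\<^esub> prod_emb y"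
    by (simp add: xy semidirect_def)
qed (auto simp: semidirect_def)

text \<open>The assumption covers two facts at once: the images of \<open>i\<close> and
  \<open>j\<close> meet only in the unit, and (taking \<open>n\<close> to be the unit)
  \<open>j\<close> has trivial kernel.\<close>

lemma prod_emb_inj:
  assumes trivial: "\<And>n h. \<lbrakk>n \<in> carrier N; h \<in> carrier H; i n = j h\<rbrakk> \<Longrightarrow> h = \<one>\<^bsub>H\<^esub>"
  shows "inj_on prod_emb (carrier (semidirect N H act))"
proof (rule inj_onI)
  fix x y assume "x \<in> carrier (semidirect N H act)" "y \<in> carrier (semidirect N H act)"
    and eq: "prod_emb x = prod_emb y"
  then obtain n h n' h' where xy: "x = (n, h)" "y = (n', h')"
    and c: "n \<in> carrier N" "h \<in> carrier H" "n' \<in> carrier N" "h' \<in> carrier H"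
    by (auto simp: semidirect_def)
  have eq: "i n \<otimes>\<^bsub>G\<^esub> j h = i n' \<otimes>\<^bsub>G\<^esub> j h'"
    using eq by (simp add: xy)
  have i_inv: "i (inv\<^bsub>N\<^esub> n') = inv\<^bsub>G\<^esub> (i n')"
    using c by (intro G.inv_equality[symmetric]) (simp_all flip: i_mult add: i_one)
  have j_inv: "j (inv\<^bsub>H\<^esub> h) = inv\<^bsub>G\<^esub> (j h)"
    using c by (intro G.inv_equality[symmetric]) (simp_all flip: j_mult add: j_one)
  have "i n = i n' \<otimes>\<^bsub>G\<^esub> j h' \<otimes>\<^bsub>G\<^esub> inv\<^bsub>G\<^esub> (j h)"
    using c eq by (simp add: G.inv_solve_right)
  then have "inv\<^bsub>G\<^esub> (i n') \<otimes>\<^bsub>G\<^esub> i n = j h' \<otimes>\<^bsub>G\<^esub> inv\<^bsub>G\<^esub> (j h)"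
    using c by (simp add: G.m_assoc[symmetric])
  then have "i (inv\<^bsub>N\<^esub> n' \<otimes>\<^bsub>N\<^esub> n) = j (h' \<otimes>\<^bsub>H\<^esub> inv\<^bsub>H\<^esub> h)"
    using c by (simp add: i_mult j_mult i_inv j_inv)
  then have "h' \<otimes>\<^bsub>H\<^esub> inv\<^bsub>H\<^esub> h = \<one>\<^bsub>H\<^esub>"
    using c by (intro trivial) auto
  then have h: "h' = h"
    using c H.inv_solve_right' by force
  with eq c have "i n = i n'" by simp
  with h c show "x = y" by (auto simp: xy dest: i_eqD)
qed

end

section \<open>Coefficients of elements of \<open>W\<close>\<close>

abbreviation L_coeff :: "W \<Rightarrow> int \<Rightarrow> complex"
  where "L_coeff x n \<equiv> Poly_Mapping.lookup x (LI n)"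

abbreviation I_coeff :: "W \<Rightarrow> int \<Rightarrow> complex"
  where "I_coeff x n \<equiv> Poly_Mapping.lookup x (II n)"

lemma W_coeff_eqI:
  "\<lbrakk>\<And>n. L_coeff x n = L_coeff y n; \<And>n. I_coeff x n = I_coeff y n\<rbrakk> \<Longrightarrow> x = y"
  by (rule poly_mapping_eqI) (metis W_index.exhaust)

lemma coeff_basis [simp]:
  "L_coeff (Lw m) n = (if m = n then 1 else 0)" "I_coeff (Lw m) n = 0"
  "L_coeff (Iw m) n = 0" "I_coeff (Iw m) n = (if m = n then 1 else 0)"
  by (simp_all add: Lw_def Iw_def lookup_single when_def)

lemma finite_L_coeff: "finite {n. L_coeff x n \<noteq> 0}"
  using finite_vimageI[OF finite_keys[of x], of LI]
  by (auto simp: inj_def vimage_def in_keys_iff)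

lemma finite_I_coeff: "finite {n. I_coeff x n \<noteq> 0}"
  using finite_vimageI[OF finite_keys[of x], of II]
  by (auto simp: inj_def vimage_def in_keys_iff)

lemma W_basis_expansion:
  assumes S: "finite S" "\<And>n. L_coeff x n \<noteq> 0 \<Longrightarrow> n \<in> S" "\<And>n. I_coeff x n \<noteq> 0 \<Longrightarrow> n \<in> S"
  shows "x = (\<Sum>m\<in>S. W_scale (L_coeff x m) (Lw m) + W_scale (I_coeff x m) (Iw m))"
proof (rule W_coeff_eqI)
  fix n
  have *: "(\<Sum>m\<in>S. c m * (if m = n then 1 else 0)) = (if n \<in> S then c n else 0)"
    for c :: "int \<Rightarrow> complex"
    using S(1) by (simp add: if_distrib cong: if_cong)
  show "L_coeff x n = L_coeff (\<Sum>m\<in>S. W_scale (L_coeff x m) (Lw m) + W_scale (I_coeff x m) (Iw m)) n"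
    "I_coeff x n = I_coeff (\<Sum>m\<in>S. W_scale (L_coeff x m) (Lw m) + W_scale (I_coeff x m) (Iw m)) n"
    using S(2,3) by (auto simp: lookup_sum lookup_add *)
qed

lemma W_linear_basis_eqI:
  assumes "Vector_Spaces.linear W_scale W_scale f" "Vector_Spaces.linear W_scale W_scale g"
    and "\<And>n. f (Lw n) = g (Lw n)" "\<And>n. f (Iw n) = g (Iw n)"
  shows "f = g"
proof
  fix x
  show "f x = g x"
  proof (rule W_linear_eqI[OF assms(1,2)])
    fix b
    show "f (Poly_Mapping.single b 1) = g (Poly_Mapping.single b 1)"
      using assms(3,4) by (cases b) (simp_all add: Lw_def Iw_def)
  qed
qed

text \<open>Multiplying a functional by the fixed vector \<open>Lw 0\<close> turns it into a linear
  map of W, so agreement on the basis suffices. Coefficient identities are proved this way.\<close>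

lemma W_functional_eqI:
  fixes f g :: "W \<Rightarrow> complex"
  assumes "\<And>x y. f (x + y) = f x + f y" "\<And>c x. f (W_scale c x) = c * f x"
    and "\<And>x y. g (x + y) = g x + g y" "\<And>c x. g (W_scale c x) = c * g x"
    and "\<And>n. f (Lw n) = g (Lw n)" "\<And>n. f (Iw n) = g (Iw n)"
  shows "f x = g x"
proof -
  have "(\<lambda>x. W_scale (f x) (Lw 0)) = (\<lambda>x. W_scale (g x) (Lw 0))"
    by (rule W_linear_basis_eqI)
      (auto intro!: W_linearI simp: assms W.scale_left_distrib)
  then have "L_coeff (W_scale (f x) (Lw 0)) 0 = L_coeff (W_scale (g x) (Lw 0)) 0"
    by metis
  then show ?thesis by simp
qed

section \<open>Coefficients of brackets\<close>

lemma W_bracket_Iw_Lw: "W_bracket (Iw m) (Lw n) = W_scale (of_int (m - n)) (Iw (m + n))"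
  by (subst W_bracket_antisym) (rule poly_mapping_eqI, simp add: W_bracket_basis algebra_simps)

text \<open>Index k is reached only from index k - m of y, with factor m - (k - m) = 2m - k.\<close>

lemma coeff_bracket_Lw:
  "L_coeff (W_bracket (Lw m) y) k = of_int (2 * m - k) * L_coeff y (k - m)"
  "I_coeff (W_bracket (Lw m) y) k = of_int (2 * m - k) * I_coeff y (k - m)"
  by (rule W_functional_eqI[where f = "\<lambda>y. L_coeff (W_bracket (Lw m) y) k"];
      force simp: W_bracket_simps W_bracket_basis lookup_add ring_distribs)
    (rule W_functional_eqI[where f = "\<lambda>y. I_coeff (W_bracket (Lw m) y) k"];
      force simp: W_bracket_simps W_bracket_basis lookup_add ring_distribs)

lemma coeff_bracket_Iw:
  "L_coeff (W_bracket (Iw m) y) k = 0"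
  "I_coeff (W_bracket (Iw m) y) k = of_int (2 * m - k) * L_coeff y (k - m)"
  by (rule W_functional_eqI[where f = "\<lambda>y. L_coeff (W_bracket (Iw m) y) k"];
      force simp: W_bracket_simps W_bracket_basis W_bracket_Iw_Lw lookup_add ring_distribs)
    (rule W_functional_eqI[where f = "\<lambda>y. I_coeff (W_bracket (Iw m) y) k"];
      force simp: W_bracket_simps W_bracket_basis W_bracket_Iw_Lw lookup_add ring_distribs)

lemma W_bracket_sum_left: "W_bracket (\<Sum>m\<in>S. f m) y = (\<Sum>m\<in>S. W_bracket (f m) y)"
proof -
  interpret Vector_Spaces.linear W_scale W_scale "\<lambda>x. W_bracket x y"
    by (rule W_bracket_linear_left)
  show ?thesis by (rule sum)
qed

text \<open>Any bracket with some I_m lies in the span of the I_n, so the I-part of x contributes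
  nothing. Allowing S to exceed the support lets later proofs sum over a convenient set such as
  \<open>{0}\<close>.\<close>

lemma L_coeff_bracket:
  assumes S: "finite S" "\<And>n. L_coeff x n \<noteq> 0 \<Longrightarrow> n \<in> S"
  shows "L_coeff (W_bracket x y) k =
    (\<Sum>m\<in>S. L_coeff x m * of_int (2 * m - k) * L_coeff y (k - m))"
proof -
  let ?S = "S \<union> {n. I_coeff x n \<noteq> 0}"
  have fin: "finite ?S" using S finite_I_coeff by simp
  have x: "x = (\<Sum>m\<in>?S. W_scale (L_coeff x m) (Lw m) + W_scale (I_coeff x m) (Iw m))"
    by (rule W_basis_expansion[OF fin]) (use S in auto)
  have "L_coeff (W_bracket x y) k =
    (\<Sum>m\<in>?S. L_coeff x m * of_int (2 * m - k) * L_coeff y (k - m))"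
    by (subst x)
      (simp add: W_bracket_sum_left lookup_sum W_bracket_simps lookup_add
        coeff_bracket_Lw coeff_bracket_Iw mult.assoc)
  also have "\<dots> = (\<Sum>m\<in>S. L_coeff x m * of_int (2 * m - k) * L_coeff y (k - m))"
    using S fin by (intro sum.mono_neutral_right) auto
  finally show ?thesis .
qed

lemma W_bracket_L_free:
  assumes "\<And>n. L_coeff x n = 0"
  shows "L_coeff (W_bracket x y) k = 0"
  using L_coeff_bracket[of "{}" x y k] assms by simp

text \<open>M and K are only upper bounds for the degrees. At index M + K the pair (M, K) alone
  contributes, and its factor M - K is nonzero unless the bounds coincide.\<close>

lemma L_coeff_bracket_lead:
  assumes x: "\<And>m. m > M \<Longrightarrow> L_coeff x m = 0" and y: "\<And>n. n > K \<Longrightarrow> L_coeff y n = 0"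
  shows "L_coeff (W_bracket x y) (M + K) = of_int (M - K) * L_coeff x M * L_coeff y K"
    and "k > M + K \<Longrightarrow> L_coeff (W_bracket x y) k = 0"
proof -
  \<comment> \<open>Inserting M keeps the leading summand present even if its coefficient is
    zero.\<close>
  let ?S = "insert M {m. L_coeff x m \<noteq> 0}"
  have S: "finite ?S" using finite_L_coeff by simp
  have bracket: "L_coeff (W_bracket x y) k =
      (\<Sum>m\<in>?S. L_coeff x m * of_int (2 * m - k) * L_coeff y (k - m))" for k
    by (rule L_coeff_bracket[OF S]) simp
  have le: "m \<le> M" if "m \<in> ?S" for m using x that by force
  have "L_coeff (W_bracket x y) (M + K) =
      (\<Sum>m\<in>?S. if m = M then of_int (M - K) * L_coeff x M * L_coeff y K else 0)"
    unfolding bracket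
  proof (rule sum.cong)
    fix m assume m: "m \<in> ?S"
    have "L_coeff y (M + K - m) = 0" if "m \<noteq> M"
      using le[OF m] that by (intro y) simp
    then show "L_coeff x m * of_int (2 * m - (M + K)) * L_coeff y (M + K - m) =
        (if m = M then of_int (M - K) * L_coeff x M * L_coeff y K else 0)" by auto
  qed simp
  then show "L_coeff (W_bracket x y) (M + K) = of_int (M - K) * L_coeff x M * L_coeff y K"
    using S by simp
  assume k: "k > M + K"
  have "L_coeff y (k - m) = 0" if "m \<in> ?S" for m
    using le[OF that] k by (intro y) simp
  then show "L_coeff (W_bracket x y) k = 0"
    unfolding bracket by (intro sum.neutral) auto
qed

lemma L_coeff_bracket_L0:
  assumes "\<And>m. m \<noteq> 0 \<Longrightarrow> L_coeff x m = 0"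
  shows "L_coeff (W_bracket x y) k = - of_int k * L_coeff x 0 * L_coeff y k"
  by (subst L_coeff_bracket[of "{0}"]) (use assms in auto)

section \<open>Diagonal and unipotent automorphisms\<close>

lemma Aut_W_iff: "f \<in> carrier Aut_W \<longleftrightarrow>
    Vector_Spaces.linear W_scale W_scale f \<and> bij f \<and>
    (\<forall>x y. f (W_bracket x y) = W_bracket (f x) (f y))"
  by (simp add: Aut_W_def lie_Aut_def)

lemma Aut_W_simps [simp]: "f \<otimes>\<^bsub>Aut_W\<^esub> g = f \<circ> g" "\<one>\<^bsub>Aut_W\<^esub> = id"
  by (simp_all add: Aut_W_def lie_Aut_def)

interpretation Aut_W: group Aut_W
  by (rule Aut_W_group)

lemma
  assumes "f \<in> carrier Aut_W"
  shows Aut_W_add: "f (x + y) = f x + f y"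
    and Aut_W_diff: "f (x - y) = f x - f y"
    and Aut_W_scale: "f (W_scale c x) = W_scale c (f x)"
    and Aut_W_bracket: "f (W_bracket x y) = W_bracket (f x) (f y)"
    and Aut_W_zero: "f 0 = 0"
proof -
  interpret Vector_Spaces.linear W_scale W_scale f
    using assms by (simp add: Aut_W_iff)
  show "f (x + y) = f x + f y" "f (x - y) = f x - f y" "f (W_scale c x) = W_scale c (f x)" "f 0 = 0"
    by (simp_all add: add diff scale)
  show "f (W_bracket x y) = W_bracket (f x) (f y)"
    using assms by (simp add: Aut_W_iff)
qed

lemma Aut_W_inv:
  assumes "f \<in> carrier Aut_W"
  shows "f ((inv\<^bsub>Aut_W\<^esub> f) x) = x" "(inv\<^bsub>Aut_W\<^esub> f) (f x) = x"
  using Aut_W.r_inv[OF assms] Aut_W.l_inv[OF assms] by (simp_all add: fun_eq_iff)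

text \<open>Bilinearity reduces compatibility with the bracket to pairs of basis vectors, first in
  the left and then in the right argument. Antisymmetry supplies the pairs of an I and an L.\<close>

lemma Aut_WI:
  assumes lin: "Vector_Spaces.linear W_scale W_scale f" and inv: "f \<circ> g = id" "g \<circ> f = id"
    and LL: "\<And>m n. f (W_bracket (Lw m) (Lw n)) = W_bracket (f (Lw m)) (f (Lw n))"
    and LI: "\<And>m n. f (W_bracket (Lw m) (Iw n)) = W_bracket (f (Lw m)) (f (Iw n))"
    and II: "\<And>m n. f (W_bracket (Iw m) (Iw n)) = W_bracket (f (Iw m)) (f (Iw n))"
  shows "f \<in> carrier Aut_W"
proof -
  interpret Vector_Spaces.linear W_scale W_scale f by (fact lin)
  have IL: "f (W_bracket (Iw m) (Lw n)) = W_bracket (f (Iw m)) (f (Lw n))" for m n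
    by (simp add: W_bracket_antisym[of "Iw m"] W_bracket_antisym[of "f (Iw m)"] LI neg)
  have "(\<lambda>x. f (W_bracket x y)) = (\<lambda>x. W_bracket (f x) (f y))"
    if "\<And>n. f (W_bracket (Lw n) y) = W_bracket (f (Lw n)) (f y)"
      "\<And>n. f (W_bracket (Iw n) y) = W_bracket (f (Iw n)) (f y)" for y
    by (rule W_linear_basis_eqI)
      (use that in \<open>auto intro!: W_linearI simp: W_bracket_simps add scale\<close>)
  then have left: "f (W_bracket x y) = W_bracket (f x) (f y)"
    if "\<And>n. f (W_bracket (Lw n) y) = W_bracket (f (Lw n)) (f y)"
      "\<And>n. f (W_bracket (Iw n) y) = W_bracket (f (Iw n)) (f y)" for x y
    using that by metis
  have right: "(\<lambda>y. f (W_bracket x y)) = (\<lambda>y. W_bracket (f x) (f y))" for x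
    by (rule W_linear_basis_eqI)
      (use left LL LI II IL in \<open>auto intro!: W_linearI simp: W_bracket_simps add scale\<close>)
  then show ?thesis
    using lin inv by (auto simp: Aut_W_iff o_bij dest: fun_cong)
qed

section \<open>The automorphisms \<open>sigma_bar\<close> with vanishing second parameter\<close>

lemma coeff_sigma_bar:
  assumes "\<epsilon> \<in> {1, -1}"
  shows "L_coeff (sigma_bar \<epsilon> 0 a \<mu> x) k = a powi (\<epsilon> * k) * of_int \<epsilon> * L_coeff x (\<epsilon> * k)"
    and "I_coeff (sigma_bar \<epsilon> 0 a \<mu> x) k = a powi (\<epsilon> * k) * \<mu> * I_coeff x (\<epsilon> * k)"
proof -
  interpret Vector_Spaces.linear W_scale W_scale "sigma_bar \<epsilon> 0 a \<mu>"
    by (rule sigma_bar_linear)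
  show "L_coeff (sigma_bar \<epsilon> 0 a \<mu> x) k = a powi (\<epsilon> * k) * of_int \<epsilon> * L_coeff x (\<epsilon> * k)"
    by (rule W_functional_eqI[where f = "\<lambda>x. L_coeff (sigma_bar \<epsilon> 0 a \<mu> x) k"])
      (use assms in \<open>auto simp: add scale sigma_bar_basis lookup_add ring_distribs\<close>)
  show "I_coeff (sigma_bar \<epsilon> 0 a \<mu> x) k = a powi (\<epsilon> * k) * \<mu> * I_coeff x (\<epsilon> * k)"
    by (rule W_functional_eqI[where f = "\<lambda>x. I_coeff (sigma_bar \<epsilon> 0 a \<mu> x) k"])
      (use assms in \<open>auto simp: add scale sigma_bar_basis lookup_add ring_distribs\<close>)
qed

text \<open>The inner map sends index n to \<epsilon>' * n, so the outer one contributes a power of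
  a with that exponent. Consequently conjugation by the sign change inverts a and fixes
  \<mu>.\<close>

lemma sigma_bar_comp:
  assumes "\<epsilon> \<in> {1, -1}" "\<epsilon>' \<in> {1, -1}" "a \<noteq> 0" "a' \<noteq> 0"
  shows "sigma_bar \<epsilon> 0 a \<mu> \<circ> sigma_bar \<epsilon>' 0 a' \<mu>' =
    sigma_bar (\<epsilon> * \<epsilon>') 0 (a powi \<epsilon>' * a') (\<mu> * \<mu>')"
proof
  fix x
  have ee: "\<epsilon> * \<epsilon>' \<in> {1, -1}" using assms by auto
  have p: "(a powi \<epsilon>' * a') powi (\<epsilon> * \<epsilon>' * k) = a powi (\<epsilon> * k) * a' powi (\<epsilon>' * (\<epsilon> * k))" for k
    using assms by (auto simp: power_int_mult_distrib power_int_mult[symmetric] ac_simps)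
  show "(sigma_bar \<epsilon> 0 a \<mu> \<circ> sigma_bar \<epsilon>' 0 a' \<mu>') x =
    sigma_bar (\<epsilon> * \<epsilon>') 0 (a powi \<epsilon>' * a') (\<mu> * \<mu>') x"
    unfolding comp_def
    by (rule W_coeff_eqI)
      (simp_all only: coeff_sigma_bar[OF assms(1)] coeff_sigma_bar[OF assms(2)]
        coeff_sigma_bar[OF ee] p, simp_all add: mult_ac)
qed

lemma sigma_bar_id: "sigma_bar 1 0 1 1 = id"
  by (auto intro!: W_coeff_eqI simp: coeff_sigma_bar)

lemma sigma_bar_Aut:
  assumes e: "\<epsilon> \<in> {1, -1}" and "a \<noteq> 0" "\<mu> \<noteq> 0"
  shows "sigma_bar \<epsilon> 0 a \<mu> \<in> carrier Aut_W"
proof (rule Aut_WI[OF sigma_bar_linear])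
  interpret Vector_Spaces.linear W_scale W_scale "sigma_bar \<epsilon> 0 a \<mu>"
    by (rule sigma_bar_linear)
  \<comment> \<open>By \<open>sigma_bar_comp\<close> the exponent \<epsilon> is what makes the
    powers of a cancel, in either order of composition.\<close>
  let ?g = "sigma_bar \<epsilon> 0 (inverse a powi \<epsilon>) (inverse \<mu>)"
  show "sigma_bar \<epsilon> 0 a \<mu> \<circ> ?g = id" "?g \<circ> sigma_bar \<epsilon> 0 a \<mu> = id"
    using assms by (subst sigma_bar_comp; auto simp: sigma_bar_id)+
  show "sigma_bar \<epsilon> 0 a \<mu> (W_bracket (Lw m) (Lw n)) =
      W_bracket (sigma_bar \<epsilon> 0 a \<mu> (Lw m)) (sigma_bar \<epsilon> 0 a \<mu> (Lw n))" for m n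
    using assms
    by (intro W_coeff_eqI) (auto simp: scale sigma_bar_basis W_bracket_simps W_bracket_basis
        power_int_add)
  show "sigma_bar \<epsilon> 0 a \<mu> (W_bracket (Lw m) (Iw n)) =
      W_bracket (sigma_bar \<epsilon> 0 a \<mu> (Lw m)) (sigma_bar \<epsilon> 0 a \<mu> (Iw n))" for m n
    using assms
    by (intro W_coeff_eqI) (auto simp: scale sigma_bar_basis W_bracket_simps W_bracket_basis
        power_int_add)
  show "sigma_bar \<epsilon> 0 a \<mu> (W_bracket (Iw m) (Iw n)) =
      W_bracket (sigma_bar \<epsilon> 0 a \<mu> (Iw m)) (sigma_bar \<epsilon> 0 a \<mu> (Iw n))" for m n
    by (simp add: sigma_bar_basis W_bracket_simps W_bracket_basis zero)
qed

section \<open>The abelian ideal spanned by the I_n and its exponentials\<close>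

lemma W_bracket_I_part:
  assumes x: "\<And>n. L_coeff x n = 0" and y: "\<And>n. L_coeff y n = 0"
  shows "W_bracket x y = 0"
proof -
  have x': "x = (\<Sum>m\<in>{n. I_coeff x n \<noteq> 0}. W_scale (L_coeff x m) (Lw m) + W_scale (I_coeff x m) (Iw m))"
    by (rule W_basis_expansion[OF finite_I_coeff]) (use x in auto)
  show ?thesis
    by (rule W_coeff_eqI; subst x')
      (simp_all add: x y W_bracket_sum_left lookup_sum W_bracket_simps coeff_bracket_Iw)
qed

lemma W_bracket_derivation:
  "W_bracket v (W_bracket x y) = W_bracket (W_bracket v x) y + W_bracket x (W_bracket v y)"
  using W_jacobi[of v x y] W_bracket_antisym[of x "W_bracket y v"] W_bracket_antisym[of y v]
    W_bracket_antisym[of y "W_bracket v x"]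
  by (simp add: W_bracket_minus_right add_eq_0_iff2 algebra_simps)

text \<open>The adjoint action of v maps W into the ideal and kills the ideal, so its square is zero
  and the exponential series stops after the linear term.\<close>

lemma lie_exp_ad_I_part:
  assumes v: "\<And>n. L_coeff v n = 0"
  shows "lie_exp W_scale (W_bracket v) x = x + W_bracket v x"
proof -
  have sq: "W_bracket v (W_bracket v y) = 0" for y
    by (rule W_bracket_I_part) (simp_all add: v W_bracket_L_free)
  have z: "(W_bracket v ^^ i) x = 0" if "i \<ge> 2" for i
  proof -
    from that obtain l where "i = Suc (Suc l)"
      by (auto simp: numeral_2_eq_2 le_iff_add)
    then show ?thesis by (simp add: sq)
  qed
  have "{i. (W_bracket v ^^ i) x \<noteq> 0} \<subseteq> {0, 1}"
  proof
    fix i assume "i \<in> {i. (W_bracket v ^^ i) x \<noteq> 0}"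
    then show "i \<in> {0, 1}" using z[of i] by (cases "i \<ge> 2") auto
  qed
  \<comment> \<open>\<open>lie_exp\<close> sums only over nonzero terms; enlarging the index set to
    {0, 1} adds zeros at most.\<close>
  then have "lie_exp W_scale (W_bracket v) x =
      (\<Sum>i\<in>{0, 1}. W_scale (1 / fact i) ((W_bracket v ^^ i) x))"
    unfolding lie_exp_def by (intro sum.mono_neutral_left) auto
  then show ?thesis by simp
qed

definition I_elem :: "(int \<Rightarrow>\<^sub>0 complex) \<Rightarrow> W"
  where "I_elem c = (\<Sum>m\<in>Poly_Mapping.keys c. W_scale (Poly_Mapping.lookup c m) (Iw m))"

lemma coeff_I_elem [simp]:
  "L_coeff (I_elem c) n = 0" "I_coeff (I_elem c) n = Poly_Mapping.lookup c n"
proof -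
  have "(\<Sum>m\<in>Poly_Mapping.keys c. Poly_Mapping.lookup c m * (if m = n then 1 else 0))
      = (\<Sum>m\<in>Poly_Mapping.keys c. if m = n then Poly_Mapping.lookup c n else 0)"
    by (intro sum.cong) auto
  then show "I_coeff (I_elem c) n = Poly_Mapping.lookup c n"
    by (simp add: I_elem_def lookup_sum in_keys_iff)
qed (simp add: I_elem_def lookup_sum)

lemma I_elem_surj:
  assumes "\<And>n. L_coeff v n = 0"
  obtains c where "v = I_elem c"
proof
  show "v = I_elem (Abs_poly_mapping (I_coeff v))"
    by (rule W_coeff_eqI) (simp_all add: assms finite_I_coeff)
qed

lemma I_elem_add: "I_elem (c + d) = I_elem c + I_elem d"
  by (rule W_coeff_eqI) (simp_all add: lookup_add)

lemma emb_Cinf_apply: "emb_Cinf c x = x + W_bracket (I_elem c) x"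
  unfolding emb_Cinf_def I_elem_def[symmetric] by (rule lie_exp_ad_I_part) simp

text \<open>The composition differs from the exponential of the sum only by a double bracket with
  ideal elements, which is zero.\<close>

lemma emb_Cinf_add: "emb_Cinf (c + d) = emb_Cinf c \<circ> emb_Cinf d"
proof
  fix x
  have "W_bracket (I_elem c) (W_bracket (I_elem d) x) = 0"
    by (rule W_bracket_I_part) (simp_all add: W_bracket_L_free)
  then show "emb_Cinf (c + d) x = (emb_Cinf c \<circ> emb_Cinf d) x"
    by (simp add: emb_Cinf_apply I_elem_add W_bracket_simps)
qed

lemma emb_Cinf_zero: "emb_Cinf 0 = id"
  by (auto simp: emb_Cinf_def lie_exp_ad_I_part W_bracket_simps W.bracket_self fun_eq_iff
      W_bracket_antisym[of 0] W_bracket_0_right)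

lemma emb_Cinf_Iw: "emb_Cinf c (Iw n) = Iw n"
  by (simp add: emb_Cinf_apply W_bracket_I_part)

lemma coeff_emb_Cinf_Lw:
  "L_coeff (emb_Cinf c (Lw n)) k = (if n = k then 1 else 0)"
  "I_coeff (emb_Cinf c (Lw n)) k = of_int (k - 2 * n) * Poly_Mapping.lookup c (k - n)"
  by (simp_all add: emb_Cinf_apply lookup_minus W_bracket_antisym[of _ "Lw n"] coeff_bracket_Lw
      algebra_simps)

lemma emb_Cinf_linear: "Vector_Spaces.linear W_scale W_scale (emb_Cinf c)"
  by (rule W_linearI) (simp_all add: emb_Cinf_apply W_bracket_simps W.scale_right_distrib)

lemma emb_Cinf_Aut: "emb_Cinf c \<in> carrier Aut_W"
proof -
  have "emb_Cinf c (W_bracket x y) = W_bracket (emb_Cinf c x) (emb_Cinf c y)" for x y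
  proof -
    \<comment> \<open>This is the only term on the right that the derivation rule does not account
      for.\<close>
    have "W_bracket (W_bracket (I_elem c) x) (W_bracket (I_elem c) y) = 0"
      by (rule W_bracket_I_part) (simp_all add: W_bracket_L_free)
    then show ?thesis
      by (simp add: emb_Cinf_apply W_bracket_simps W_bracket_derivation[of "I_elem c"] add_ac)
  qed
  moreover have "bij (emb_Cinf c)"
    by (rule o_bij[of "emb_Cinf (- c)"]) (simp_all add: emb_Cinf_add[symmetric] emb_Cinf_zero)
  ultimately show ?thesis
    using emb_Cinf_linear by (simp add: Aut_W_iff)
qed

lemma emb_Cinf_inj: "inj emb_Cinf"
proof (rule injI, rule poly_mapping_eqI)
  fix c d k assume eq: "emb_Cinf c = emb_Cinf d"
  \<comment> \<open>The choice n = k + 1 makes the factor (2k + 1) - 2(k + 1) = -1, which is nonzero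
    for every k.\<close>
  have *: "Poly_Mapping.lookup e k = - I_coeff (emb_Cinf e (Lw (k + 1))) (2 * k + 1)"
    for e
    by (simp add: coeff_emb_Cinf_Lw)
  show "Poly_Mapping.lookup c k = Poly_Mapping.lookup d k"
    unfolding * eq ..
qed

section \<open>Every automorphism is of the expected form\<close>

lemma ex_top_degree:
  fixes x :: W
  assumes "L_coeff x m \<noteq> 0"
  obtains M where "M \<ge> m" "L_coeff x M \<noteq> 0" "\<And>n. n > M \<Longrightarrow> L_coeff x n = 0"
proof
  let ?S = "{n. L_coeff x n \<noteq> 0}"
  have S: "finite ?S" "m \<in> ?S" using finite_L_coeff assms by auto
  then show "Max ?S \<ge> m" by simp
  show "L_coeff x (Max ?S) \<noteq> 0" using S Max_in[of ?S] by auto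
  show "L_coeff x n = 0" if "n > Max ?S" for n
    using that S(1) Max_ge[of ?S n] by (metis (mono_tags) linorder_not_less mem_Collect_eq)
qed

lemma ad_square_zero_L_coeff:
  assumes "\<And>w. W_bracket x (W_bracket x w) = 0"
  shows "L_coeff x m = 0"
proof (rule ccontr)
  assume "L_coeff x m \<noteq> 0"
  then obtain M where M: "L_coeff x M \<noteq> 0" "\<And>n. n > M \<Longrightarrow> L_coeff x n = 0"
    by (rule ex_top_degree) blast
  \<comment> \<open>The two leading factors are M - K and M - (M + K) = -K; this K makes both
    nonzero.\<close>
  define K where "K = \<bar>M\<bar> + 1"
  have top: "L_coeff (Lw K) n = 0" if "n > K" for n using that by simp
  note lead1 = L_coeff_bracket_lead[of M x K "Lw K", OF M(2) top]
  note lead2 = L_coeff_bracket_lead(1)[of M x "M + K" "W_bracket x (Lw K)", OF M(2) lead1(2)]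
  have "of_int (M - (M + K)) * L_coeff x M * (of_int (M - K) * L_coeff x M) = 0"
    using lead2 by (simp add: lead1(1) assms)
  then have "of_int (- K) = (0 :: complex) \<or> of_int (M - K) = (0 :: complex)"
    using M(1) by (auto simp del: of_int_diff of_int_minus)
  then show False
    unfolding of_int_eq_0_iff by (auto simp: K_def)
qed

text \<open>For x in the ideal the square of its adjoint action is zero. Every w is an image under
  f, so the same holds for f x, and \<open>ad_square_zero_L_coeff\<close> applies.\<close>

lemma Aut_W_I_part:
  assumes f: "f \<in> carrier Aut_W" and x: "\<And>n. L_coeff x n = 0"
  shows "L_coeff (f x) m = 0"
proof (rule ad_square_zero_L_coeff)
  fix w
  have "W_bracket x (W_bracket x ((inv\<^bsub>Aut_W\<^esub> f) w)) = 0"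
    by (rule W_bracket_I_part) (simp_all add: x W_bracket_L_free)
  then have "f (W_bracket x (W_bracket x ((inv\<^bsub>Aut_W\<^esub> f) w))) = 0"
    using f by (simp add: Aut_W_zero)
  then show "W_bracket (f x) (W_bracket (f x) w) = 0"
    using f by (simp add: Aut_W_bracket Aut_W_inv)
qed

text \<open>This makes f well defined on the quotient by the ideal.\<close>

lemma Aut_W_L_coeff_cong:
  assumes f: "f \<in> carrier Aut_W" and "\<And>n. L_coeff x n = L_coeff y n"
  shows "L_coeff (f x) m = L_coeff (f y) m"
  using Aut_W_I_part[OF f, of "x - y" m] assms by (simp add: Aut_W_diff lookup_minus)

section \<open>Images of the L_n modulo the ideal\<close>

lemma Aut_W_eigen:
  assumes "f \<in> carrier Aut_W"
  shows "W_bracket (f (Lw 0)) (f (Lw n)) = W_scale (- of_int n) (f (Lw n))"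
  by (simp only: Aut_W_bracket[OF assms, symmetric] Aut_W_scale[OF assms, symmetric]
      W_bracket_basis diff_0 add_0 of_int_minus)

text \<open>If \<open>f L\<^sub>0\<close> had top degree \<open>M > 0\<close>, no eigenvector of its adjoint action could have top degree
  above \<open>M\<close>, so the eigenvectors could not span \<open>W\<close> modulo the ideal.\<close>

lemma Aut_W_L0_pos:
  assumes f: "f \<in> carrier Aut_W" and "m > 0"
  shows "L_coeff (f (Lw 0)) m = 0"
proof (rule ccontr)
  assume "L_coeff (f (Lw 0)) m \<noteq> 0"
  then obtain M where M: "M \<ge> m" "L_coeff (f (Lw 0)) M \<noteq> 0"
    "\<And>n. n > M \<Longrightarrow> L_coeff (f (Lw 0)) n = 0"
    by (rule ex_top_degree) blast
  have L: "L_coeff (f (Lw n)) (M + 1) = 0" for n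
  proof (rule ccontr)
    assume "L_coeff (f (Lw n)) (M + 1) \<noteq> 0"
    then obtain K where K: "K \<ge> M + 1" "L_coeff (f (Lw n)) K \<noteq> 0"
      "\<And>k. k > K \<Longrightarrow> L_coeff (f (Lw n)) k = 0"
      by (rule ex_top_degree) blast
    have "of_int (M - K) * L_coeff (f (Lw 0)) M * L_coeff (f (Lw n)) K =
        - of_int n * L_coeff (f (Lw n)) (M + K)"
      using L_coeff_bracket_lead(1)[of M "f (Lw 0)" K "f (Lw n)", OF M(3) K(3)]
      by (simp add: Aut_W_eigen[OF f])
    \<comment> \<open>The index M + K exceeds K because M is positive.\<close>
    also have "\<dots> = 0" using K(3)[of "M + K"] M(1) \<open>m > 0\<close> by simp
    finally have "of_int (M - K) = (0 :: complex)"
      using M(2) K(2) by (simp del: of_int_diff)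
    then show False using K(1) unfolding of_int_eq_0_iff by simp
  qed
  \<comment> \<open>No element of the image has a component along \<open>Lw (M + 1)\<close>, against
    surjectivity.\<close>
  have "L_coeff (f x) (M + 1) = 0" for x
    by (rule W_functional_eqI[where f = "\<lambda>x. L_coeff (f x) (M + 1)" and g = "\<lambda>_. 0"])
      (simp_all add: f L Aut_W_add Aut_W_scale Aut_W_I_part lookup_add)
  from this[of "(inv\<^bsub>Aut_W\<^esub> f) (Lw (M + 1))"] show False
    using f by (simp add: Aut_W_inv)
qed

text \<open>Negative degrees become positive after composing with the automorphism that reverses the
  indices.\<close>

lemma Aut_W_L0_nonzero:
  assumes f: "f \<in> carrier Aut_W" and "m \<noteq> 0"
  shows "L_coeff (f (Lw 0)) m = 0"
proof (cases "m > 0")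
  case True
  then show ?thesis by (rule Aut_W_L0_pos[OF f])
next
  case False
  have "sigma_bar (- 1) 0 1 1 \<otimes>\<^bsub>Aut_W\<^esub> f \<in> carrier Aut_W"
    using f by (intro Aut_W.m_closed sigma_bar_Aut) auto
  then have "L_coeff ((sigma_bar (- 1) 0 1 1 \<circ> f) (Lw 0)) (- m) = 0"
    unfolding Aut_W_simps by (rule Aut_W_L0_pos) (use False \<open>m \<noteq> 0\<close> in simp)
  then show ?thesis by (simp add: coeff_sigma_bar)
qed

text \<open>Modulo the ideal f L_0 is c L_0, whose adjoint action has eigenvalue -ck on L_k.
  Comparison with the eigenvalue -n of f L_n leaves only indices with ck = n.\<close>

lemma Aut_W_weight:
  assumes f: "f \<in> carrier Aut_W"
  shows "(L_coeff (f (Lw 0)) 0 * of_int k - of_int n) * L_coeff (f (Lw n)) k = 0"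
  using L_coeff_bracket_L0[OF Aut_W_L0_nonzero[OF f], of "f (Lw n)" k]
  by (auto simp: Aut_W_eigen[OF f] algebra_simps)

lemma Aut_W_L_part_nonzero:
  assumes f: "f \<in> carrier Aut_W"
  obtains k where "L_coeff (f (Lw n)) k \<noteq> 0"
proof -
  have "\<exists>k. L_coeff (f (Lw n)) k \<noteq> 0"
  proof (rule ccontr)
    assume "\<nexists>k. L_coeff (f (Lw n)) k \<noteq> 0"
    then have "L_coeff ((inv\<^bsub>Aut_W\<^esub> f) (f (Lw n))) n = 0"
      by (intro Aut_W_I_part[OF Aut_W.inv_closed[OF f]]) simp
    then show False using f by (simp add: Aut_W_inv)
  qed
  then show thesis using that by blast
qed

text \<open>Since f L_1 is nonzero modulo the ideal, the weight equation gives an integer k with ck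
  = 1, and likewise an integer l for the inverse automorphism. The two coefficients are reciprocal,
  so kl = 1.\<close>

lemma Aut_W_L0_unit:
  assumes f: "f \<in> carrier Aut_W"
  obtains \<epsilon> where "\<epsilon> \<in> {1, -1}" "L_coeff (f (Lw 0)) 0 = of_int \<epsilon>"
proof -
  have unit: "\<exists>k. L_coeff (g (Lw 0)) 0 * of_int k = 1" if g: "g \<in> carrier Aut_W" for g
  proof -
    from g obtain k where "L_coeff (g (Lw 1)) k \<noteq> 0" by (rule Aut_W_L_part_nonzero)
    then show ?thesis using Aut_W_weight[OF g, of k 1] by auto
  qed
  define g where "g = inv\<^bsub>Aut_W\<^esub> f"
  have g: "g \<in> carrier Aut_W" using f by (simp add: g_def)
  from unit[OF f] unit[OF g] obtain k l
    where k: "L_coeff (f (Lw 0)) 0 * of_int k = 1" and l: "L_coeff (g (Lw 0)) 0 * of_int l = 1"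
    by blast
  have "L_coeff (f (g (Lw 0))) 0 = L_coeff (f (W_scale (L_coeff (g (Lw 0)) 0) (Lw 0))) 0"
    using Aut_W_L0_nonzero[OF g] by (intro Aut_W_L_coeff_cong[OF f]) auto
  then have "L_coeff (g (Lw 0)) 0 * L_coeff (f (Lw 0)) 0 = 1"
    using f by (simp add: g_def Aut_W_inv Aut_W_scale)
  then have "of_int (k * l) = (1 :: complex)"
    using k l by (simp add: field_simps) (metis mult.assoc mult.commute mult.left_neutral)
  then have "k * l = 1" unfolding of_int_eq_1_iff .
  then have "k \<in> {1, -1}" by (auto simp: zmult_eq_1_iff)
  moreover from this k have "L_coeff (f (Lw 0)) 0 = of_int k"
    by (auto simp: minus_equation_iff)
  ultimately show thesis by (rule that)
qed

text \<open>The bracket of L_m with L_n has factor m - n and says nothing when m = n. The missing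
  value at 2 = 1 + 1 is recovered from the pairs (2, -1) and (1, -1).\<close>

lemma multiplicative_off_diagonal:
  fixes b :: "int \<Rightarrow> complex"
  assumes b0: "b 0 = 1" and mult: "\<And>m n. m \<noteq> n \<Longrightarrow> b (m + n) = b m * b n"
  shows "b 1 \<noteq> 0 \<and> b n = b 1 powi n"
proof -
  have inv: "b 1 * b (-1) = 1" using mult[of 1 "-1"] b0 by simp
  have "b 2 * b (- 1) = b 1" using mult[of 2 "-1"] by simp
  then have "b 2 = b 1 * b 1" using inv by (metis mult.assoc mult.commute mult.right_neutral)
  then have step: "b (n + 1) = b n * b 1" for n
    using mult[of n 1] by (cases "n = 1") auto
  have nz: "b 1 \<noteq> 0" using inv by auto
  have "b n = b 1 powi n"
  proof (induction n rule: int_induct[where k = 0])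
    case base
    show ?case by (simp add: b0)
  next
    case (step1 i)
    then show ?case using step[of i] nz by (simp add: power_int_add)
  next
    case (step2 i)
    then show ?case using step[of "i - 1"] nz by (simp add: power_int_diff field_simps)
  qed
  with nz show ?thesis by simp
qed

text \<open>Additive counterpart, with the same detour through the pairs (2, -1) and (1,
  -1).\<close>

lemma additive_off_diagonal:
  fixes d :: "int \<Rightarrow> complex"
  assumes add: "\<And>m n. m \<noteq> n \<Longrightarrow> d (m + n) = d m + d n"
  shows "d n = of_int n * d 1"
proof -
  have d0: "d 0 = 0" using add[of 1 0] by simp
  have "d 2 + d (- 1) = d 1" "d 1 + d (-1) = 0" using add[of 2 "-1"] add[of 1 "-1"] d0 by simp_all
  then have "d 2 = d 1 + d 1" by (simp add: algebra_simps eq_neg_iff_add_eq_0[symmetric])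
  then have step: "d (n + 1) = d n + d 1" for n
    using add[of n 1] by (cases "n = 1") auto
  show ?thesis
  proof (induction n rule: int_induct[where k = 0])
    case (step2 i)
    then show ?case using step[of "i - 1"] by (simp add: algebra_simps)
  qed (simp_all add: d0 step algebra_simps)
qed

lemma Aut_W_L_part:
  assumes f: "f \<in> carrier Aut_W"
  obtains \<epsilon> a where "\<epsilon> \<in> {1, -1}" "a \<noteq> 0"
    "\<And>n k. L_coeff (f (Lw n)) k = (if k = \<epsilon> * n then of_int \<epsilon> * a powi n else 0)"
proof -
  obtain \<epsilon> where e: "\<epsilon> \<in> {1, -1}" and c0: "L_coeff (f (Lw 0)) 0 = of_int \<epsilon>"
    by (rule Aut_W_L0_unit[OF f])
  have supp: "L_coeff (f (Lw n)) k = 0" if "k \<noteq> \<epsilon> * n" for n k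
  proof -
    have "of_int (\<epsilon> * k - n) * L_coeff (f (Lw n)) k = 0"
      using Aut_W_weight[OF f, of k n] by (simp add: c0)
    moreover have "\<epsilon> * k - n \<noteq> 0" using that e by auto
    ultimately show ?thesis unfolding mult_eq_0_iff of_int_eq_0_iff by simp
  qed
  \<comment> \<open>The bracket of the images carries an extra factor \<epsilon>; normalising by
    \<epsilon> absorbs it and gives b 0 = 1.\<close>
  define b where "b n = of_int \<epsilon> * L_coeff (f (Lw n)) (\<epsilon> * n)" for n
  have ee: "of_int \<epsilon> * of_int \<epsilon> = (1 :: complex)" using e by auto
  have b0: "b 0 = 1" by (simp add: b_def c0 ee)
  have mult: "b (m + n) = b m * b n" if "m \<noteq> n" for m n
  proof -
    have "L_coeff (f (W_bracket (Lw m) (Lw n))) (\<epsilon> * (m + n)) =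
        L_coeff (W_bracket (f (Lw m)) (f (Lw n))) (\<epsilon> * (m + n))"
      by (simp add: Aut_W_bracket[OF f])
    moreover have "L_coeff (W_bracket (f (Lw m)) (f (Lw n))) (\<epsilon> * (m + n)) =
        of_int (m - n) * (of_int \<epsilon> * L_coeff (f (Lw m)) (\<epsilon> * m) * L_coeff (f (Lw n)) (\<epsilon> * n))"
      using supp[of _ m] by (subst L_coeff_bracket[of "{\<epsilon> * m}"]) (auto simp: algebra_simps)
    ultimately have "of_int (m - n) * L_coeff (f (Lw (m + n))) (\<epsilon> * (m + n)) =
        of_int (m - n) * (of_int \<epsilon> * L_coeff (f (Lw m)) (\<epsilon> * m) * L_coeff (f (Lw n)) (\<epsilon> * n))"
      by (simp add: W_bracket_basis Aut_W_scale[OF f])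
    moreover have "of_int (m - n) \<noteq> (0 :: complex)"
      unfolding of_int_eq_0_iff using that by simp
    ultimately show ?thesis by (simp add: b_def mult_ac)
  qed
  note b = multiplicative_off_diagonal[of b, OF b0 mult]
  have "L_coeff (f (Lw n)) k = (if k = \<epsilon> * n then of_int \<epsilon> * b 1 powi n else 0)" for n k
  proof (cases "k = \<epsilon> * n")
    case True
    have "of_int \<epsilon> * b n = L_coeff (f (Lw n)) (\<epsilon> * n)"
      using ee by (simp add: b_def flip: mult.assoc)
    with True b[of n] show ?thesis by simp
  qed (simp add: supp)
  then show thesis using that e b by blast
qed

section \<open>Automorphisms inducing the identity modulo the ideal\<close>

lemma Aut_W_fix_L_scale_I:
  assumes f: "f \<in> carrier Aut_W"
    and L: "\<And>n k. L_coeff (f (Lw n)) k = (if n = k then 1 else 0)"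
  obtains \<mu> where "\<mu> \<noteq> 0" "\<And>n. f (Iw n) = W_scale \<mu> (Iw n)"
proof -
  have LI: "W_bracket (Lw m) (f (Iw n)) = W_scale (of_int (m - n)) (f (Iw (m + n)))" for m n
  proof -
    \<comment> \<open>The difference lies in the abelian ideal, so f L_m and L_m act alike on
      it.\<close>
    have "W_bracket (f (Lw m) - Lw m) (f (Iw n)) = 0"
      by (rule W_bracket_I_part) (simp_all add: lookup_minus L Aut_W_I_part[OF f])
    then have "W_bracket (Lw m) (f (Iw n)) = W_bracket (f (Lw m)) (f (Iw n))"
      using W_bracket_simps(1)[of "f (Lw m) - Lw m" "Lw m" "f (Iw n)"] by simp
    then show ?thesis
      by (simp add: W_bracket_basis Aut_W_scale[OF f] flip: Aut_W_bracket[OF f])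
  qed
  have coeff: "of_int (2 * m - k) * I_coeff (f (Iw n)) (k - m) =
      of_int (m - n) * I_coeff (f (Iw (m + n))) k" for m n k
    using arg_cong[OF LI[of m n], of "\<lambda>x. I_coeff x k"] by (simp add: coeff_bracket_Lw)
  have supp: "I_coeff (f (Iw n)) k = 0" if "k \<noteq> n" for n k
    using coeff[of 0 k n] that by simp
  define \<mu> where "\<mu> n = I_coeff (f (Iw n)) n" for n
  \<comment> \<open>Applying the identity to the bracket of L_n with I_0 compares the two scalars up
    to the factor n.\<close>
  have "\<mu> n = \<mu> 0" for n
    using coeff[of n n 0] by (cases "n = 0") (auto simp: \<mu>_def)
  then have "f (Iw n) = W_scale (\<mu> 0) (Iw n)" for n
    using supp[of _ n] by (intro W_coeff_eqI) (auto simp: Aut_W_I_part[OF f] \<mu>_def)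
  moreover have "\<mu> 0 \<noteq> 0"
  proof
    assume "\<mu> 0 = 0"
    then have "f (Iw 0) = f 0" using calculation[of 0] by (simp add: Aut_W_zero[OF f])
    then have "Iw 0 = 0" using f by (auto simp: Aut_W_iff bij_def dest: injD)
    then have "I_coeff (Iw 0) 0 = 0" by (metis lookup_zero)
    then show False by simp
  qed
  ultimately show thesis using that by blast
qed

text \<open>Away from \<open>k = n\<close> the cocycle identity with \<open>L\<^sub>0\<close> determines the \<open>I\<^sub>k\<close>-coefficient of
  \<open>f L\<^sub>n - L\<^sub>n\<close>; the diagonal coefficients are additive in \<open>n\<close> and account for \<open>ad I\<^sub>0\<close>.\<close>

lemma Aut_W_unipotent:
  assumes f: "f \<in> carrier Aut_W"
    and L: "\<And>n k. L_coeff (f (Lw n)) k = (if n = k then 1 else 0)"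
    and I: "\<And>n. f (Iw n) = Iw n"
  obtains c where "f = emb_Cinf c"
proof -
  define u where "u n = f (Lw n) - Lw n" for n
  have fu: "f (Lw n) = Lw n + u n" for n by (simp add: u_def)
  have uL: "L_coeff (u n) k = 0" for n k by (simp add: u_def lookup_minus L)
  have "W_scale (of_int (m - n)) (Lw (m + n) + u (m + n)) =
      W_bracket (Lw m + u m) (Lw n + u n)" for m n
    by (simp add: W_bracket_basis Aut_W_scale[OF f] flip: fu Aut_W_bracket[OF f])
  \<comment> \<open>Without this second-order term, compatibility with the bracket becomes a linear
    cocycle condition on u.\<close>
  moreover have "W_bracket (u m) (u n) = 0" for m n
    by (simp add: W_bracket_I_part uL)
  ultimately have cocycle: "W_scale (of_int (m - n)) (u (m + n)) =
      W_bracket (Lw m) (u n) - W_bracket (Lw n) (u m)" for m n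
    by (simp add: W_bracket_simps W_bracket_basis W.scale_right_distrib
        W_bracket_antisym[of "u m" "Lw n"])
  have coeff: "of_int (m - n) * I_coeff (u (m + n)) k =
      of_int (2 * m - k) * I_coeff (u n) (k - m) - of_int (2 * n - k) * I_coeff (u m) (k - n)"
    for m n k
    using arg_cong[OF cocycle[of m n], of "\<lambda>x. I_coeff x k"]
    by (simp add: lookup_minus coeff_bracket_Lw)
  define d where "d n = I_coeff (u n) n" for n
  have d: "d n = of_int n * d 1" for n
  proof (rule additive_off_diagonal)
    fix m n :: int assume "m \<noteq> n"
    then have nz: "of_int (m - n) \<noteq> (0 :: complex)" unfolding of_int_eq_0_iff by simp
    have "of_int (m - n) * d (m + n) = of_int (m - n) * (d m + d n)"
      using coeff[of m n "m + n"] by (simp add: d_def algebra_simps)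
    with nz show "d (m + n) = d m + d n" by simp
  qed
  have off: "of_int (k - n) * I_coeff (u n) k = of_int (k - 2 * n) * I_coeff (u 0) (k - n)" for n k
    using coeff[of 0 n k] by (simp add: algebra_simps)
  \<comment> \<open>For k different from n the value is read off from \<open>off\<close> with j = k
    - n. At k = n the factor k - 2n is -n, hence the sign in v 0.\<close>
  define v where "v = (\<lambda>j. if j = 0 then - d 1 else I_coeff (u 0) j / of_int j)"
  have "finite {j. v j \<noteq> 0}"
    by (rule finite_subset[of _ "insert 0 {j. I_coeff (u 0) j \<noteq> 0}"])
      (auto simp: v_def finite_I_coeff)
  then have v: "Poly_Mapping.lookup (Abs_poly_mapping v) = v"
    by simp
  have uv: "I_coeff (u n) k = of_int (k - 2 * n) * v (k - n)" for n k
  proof (cases "k = n")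
    case True
    then show ?thesis using d[of n] by (simp add: v_def d_def)
  next
    case False
    then have "of_int (k - n) \<noteq> (0 :: complex)" unfolding of_int_eq_0_iff by simp
    then show ?thesis
      using off[of k n] False by (simp add: v_def eq_divide_eq mult.commute)
  qed
  have "f = emb_Cinf (Abs_poly_mapping v)"
  proof (rule W_linear_basis_eqI[OF _ emb_Cinf_linear])
    show "Vector_Spaces.linear W_scale W_scale f" using f by (simp add: Aut_W_iff)
    show "f (Lw n) = emb_Cinf (Abs_poly_mapping v) (Lw n)" for n
      by (rule W_coeff_eqI) (simp_all add: fu lookup_add uL uv coeff_emb_Cinf_Lw v)
    show "f (Iw n) = emb_Cinf (Abs_poly_mapping v) (Iw n)" for n
      by (simp add: I emb_Cinf_Iw)
  qed
  then show thesis by (rule that)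
qed

lemma Aut_W_decomposition:
  assumes f: "f \<in> carrier Aut_W"
  obtains \<epsilon> a \<mu> c where "\<epsilon> \<in> {1, -1}" "a \<noteq> 0" "\<mu> \<noteq> 0" "f = sigma_bar \<epsilon> 0 a \<mu> \<circ> emb_Cinf c"
proof -
  obtain \<epsilon> a where e: "\<epsilon> \<in> {1, -1}" and a: "a \<noteq> 0"
    and fL: "\<And>n k. L_coeff (f (Lw n)) k = (if k = \<epsilon> * n then of_int \<epsilon> * a powi n else 0)"
    using f by (rule Aut_W_L_part) blast
  \<comment> \<open>The scalar on the I_n is still unknown, so it is set to 1 here and corrected by
    \<open>?t\<close> below.\<close>
  let ?s = "sigma_bar \<epsilon> 0 a 1"
  have s: "?s \<in> carrier Aut_W" using e a by (simp add: sigma_bar_Aut)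
  define g where "g = (inv\<^bsub>Aut_W\<^esub> ?s) \<circ> f"
  have g: "g \<in> carrier Aut_W"
    using Aut_W.m_closed[OF Aut_W.inv_closed[OF s] f] by (simp add: g_def)
  have sg: "?s (g x) = f x" for x by (simp add: g_def Aut_W_inv[OF s])
  have gL: "L_coeff (g (Lw n)) k = (if n = k then 1 else 0)" for n k
  proof -
    have "a powi k * of_int \<epsilon> * L_coeff (g (Lw n)) k = L_coeff (?s (g (Lw n))) (\<epsilon> * k)"
      using e by (auto simp: coeff_sigma_bar)
    also have "\<dots> = (if n = k then a powi k * of_int \<epsilon> * 1 else 0)"
      using e by (auto simp: sg fL)
    finally show ?thesis using e a by (auto split: if_splits)
  qed
  obtain \<mu> where mu: "\<mu> \<noteq> 0" and gI: "\<And>n. g (Iw n) = W_scale \<mu> (Iw n)"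
    using g gL by (rule Aut_W_fix_L_scale_I) blast
  let ?t = "sigma_bar 1 0 1 (1 / \<mu>)"
  have t: "?t \<in> carrier Aut_W" using mu by (simp add: sigma_bar_Aut)
  have "?t \<circ> g \<in> carrier Aut_W"
    using Aut_W.m_closed[OF t g] by simp
  then obtain c where c: "?t \<circ> g = emb_Cinf c"
  proof (rule Aut_W_unipotent)
    show "L_coeff ((?t \<circ> g) (Lw n)) k = (if n = k then 1 else 0)" for n k
      by (simp add: coeff_sigma_bar gL)
    show "(?t \<circ> g) (Iw n) = Iw n" for n
      using mu by (intro W_coeff_eqI) (auto simp: coeff_sigma_bar gI)
  qed
  \<comment> \<open>The two corrections recombine, so f = \<open>?s\<close> \<circ> g becomes the
    diagonal map followed on the right by \<open>?t\<close> \<circ> g.\<close>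
  have "sigma_bar \<epsilon> 0 a \<mu> \<circ> ?t = ?s"
    using e a mu by (subst sigma_bar_comp) auto
  then have "f = sigma_bar \<epsilon> 0 a \<mu> \<circ> emb_Cinf c"
    unfolding c[symmetric] by (metis comp_apply sg ext)
  with e a mu show thesis by (rule that)
qed

section \<open>Identification of the factors\<close>

lemma Z2_group: "group Z2"
  by (rule groupI) (auto simp: Z2_def)

lemma Cstar_group: "group Cstar"
proof (rule groupI)
  fix x assume "x \<in> carrier Cstar"
  then show "\<exists>y\<in>carrier Cstar. y \<otimes>\<^bsub>Cstar\<^esub> x = \<one>\<^bsub>Cstar\<^esub>"
    by (intro bexI[of _ "inverse x"]) (auto simp: Cstar_def)
qed (auto simp: Cstar_def)

lemma Cinf_group: "group Cinf"
proof (rule groupI)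
  fix x
  show "\<exists>y\<in>carrier Cinf. y \<otimes>\<^bsub>Cinf\<^esub> x = \<one>\<^bsub>Cinf\<^esub>"
    by (intro bexI[of _ "- x"]) (auto simp: Cinf_def)
qed (auto simp: Cinf_def add.assoc)

lemma carrier_Cstar: "carrier Cstar = - {0}"
  by (simp add: Cstar_def)

section \<open>The factors and their images in the automorphism group\<close>

lemma emb_Z2_hom: "emb_Z2 \<in> hom Z2 Aut_W"
  by (rule homI) (auto simp: emb_Z2_def Z2_def sigma_bar_Aut sigma_bar_comp)

lemma emb_CC_hom: "emb_CC \<in> hom (Cstar \<times>\<times> Cstar) Aut_W"
  by (rule homI) (auto simp: emb_CC_def DirProd_def Cstar_def sigma_bar_comp intro!: sigma_bar_Aut)

lemma emb_Cinf_hom: "emb_Cinf \<in> hom Cinf Aut_W"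
  by (rule homI) (simp_all add: Cinf_def emb_Cinf_Aut emb_Cinf_add)

lemma sigma_bar_inj:
  assumes "\<epsilon> \<in> {1, -1}" "\<epsilon>' \<in> {1, -1}" "a \<noteq> 0"
    and eq: "sigma_bar \<epsilon> 0 a \<mu> = sigma_bar \<epsilon>' 0 a' \<mu>'"
  shows "\<epsilon> = \<epsilon>' \<and> a = a' \<and> \<mu> = \<mu>'"
proof -
  \<comment> \<open>The image of L_1 detects \<epsilon> and a; the image of I_0 carries no power of
    a and detects \<mu>.\<close>
  have L: "L_coeff (sigma_bar \<epsilon> 0 a \<mu> (Lw 1)) \<epsilon> = L_coeff (sigma_bar \<epsilon>' 0 a' \<mu>' (Lw 1)) \<epsilon>"
    and I: "I_coeff (sigma_bar \<epsilon> 0 a \<mu> (Iw 0)) 0 = I_coeff (sigma_bar \<epsilon>' 0 a' \<mu>' (Iw 0)) 0"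
    by (simp_all add: eq)
  have "\<epsilon> = \<epsilon>' \<and> a = a'"
    using L assms(1-3) by (auto simp: sigma_bar_basis lookup_add)
  then show ?thesis using I by (simp add: sigma_bar_basis)
qed

lemma emb_Z2_iso: "emb_Z2 \<in> iso Z2 (Aut_W\<lparr>carrier := sub_a\<rparr>)"
proof -
  have "inj_on emb_Z2 (carrier Z2)"
  proof (rule inj_onI)
    fix x y assume "x \<in> carrier Z2" "y \<in> carrier Z2" "emb_Z2 x = emb_Z2 y"
    then show "x = y"
      using sigma_bar_inj[of x y 1 1 1 1] by (simp add: emb_Z2_def Z2_def)
  qed
  moreover have "emb_Z2 ` carrier Z2 = sub_a"
    by (auto simp: emb_Z2_def Z2_def sub_a_def)
  ultimately show ?thesis
    using emb_Z2_hom by (auto simp: iso_def bij_betw_def hom_def)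
qed

lemma emb_CC_inj: "inj_on emb_CC (carrier (Cstar \<times>\<times> Cstar))"
proof (rule inj_onI)
  fix x y
  assume "x \<in> carrier (Cstar \<times>\<times> Cstar)" "y \<in> carrier (Cstar \<times>\<times> Cstar)" "emb_CC x = emb_CC y"
  then show "x = y"
    using sigma_bar_inj[of 1 1 "fst x" "snd x" "fst y" "snd y"]
    by (auto simp: emb_CC_def carrier_Cstar)
qed

lemma emb_CC_iso: "emb_CC \<in> iso (Cstar \<times>\<times> Cstar) (Aut_W\<lparr>carrier := sub_b\<rparr>)"
proof -
  have "emb_CC ` carrier (Cstar \<times>\<times> Cstar) = sub_b"
    by (simp add: emb_CC_def carrier_Cstar sub_b_def set_eq_iff image_iff Bex_def) blast
  then show ?thesis
    using emb_CC_hom emb_CC_inj by (auto simp: iso_def bij_betw_def hom_def)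
qed

lemma I_elem_single: "I_elem (Poly_Mapping.single m k) = W_scale k (Iw m)"
  by (rule W_coeff_eqI) (auto simp: lookup_single when_def)

lemma lie_exp_ad_Iw:
  "lie_exp W_scale (\<lambda>x. W_scale k (W_bracket (Iw m) x)) = emb_Cinf (Poly_Mapping.single m k)"
  unfolding emb_Cinf_def I_elem_def[symmetric] I_elem_single W_bracket_simps(3) ..

lemma range_emb_Cinf_subgroup: "subgroup (range emb_Cinf) Aut_W"
proof -
  interpret group_hom Cinf Aut_W emb_Cinf
    by (intro group_hom.intro group_hom_axioms.intro Cinf_group Aut_W_group emb_Cinf_hom)
  show ?thesis using img_is_subgroup by (simp add: Cinf_def)
qed

lemma sub_t_subset: "sub_t \<subseteq> range emb_Cinf"
proof -
  \<comment> \<open>The sign comes from the bracket of I_0 with L_n, which is -n I_n.\<close>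
  have "sigma_bar 1 l 1 1 = emb_Cinf (Poly_Mapping.single 0 (- l))" for l
  proof (rule W_linear_basis_eqI[OF sigma_bar_linear emb_Cinf_linear])
    show "sigma_bar 1 l 1 1 (Lw n) = emb_Cinf (Poly_Mapping.single 0 (- l)) (Lw n)" for n
      by (rule W_coeff_eqI)
        (auto simp: sigma_bar_basis coeff_emb_Cinf_Lw lookup_add lookup_single when_def)
    show "sigma_bar 1 l 1 1 (Iw n) = emb_Cinf (Poly_Mapping.single 0 (- l)) (Iw n)" for n
      by (simp add: sigma_bar_basis emb_Cinf_Iw)
  qed
  then show ?thesis by (auto simp: sub_t_def)
qed

text \<open>Induction on the entries of c: each new entry contributes one generator as a
  factor.\<close>

lemma emb_Cinf_in_sub_Z: "emb_Cinf c \<in> sub_Z"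
proof (induction c rule: update_induct)
  case const
  show ?case by (simp add: emb_Cinf_zero sub_Z_def flip: Aut_W_simps(2)) (rule generate.one)
next
  case (update f m k)
  \<comment> \<open>The index m is new in f, so updating is the same as adding.\<close>
  have "Poly_Mapping.update m k f = f + Poly_Mapping.single m k"
    using update by (intro poly_mapping_eqI)
      (auto simp: lookup_update lookup_add lookup_single when_def in_keys_iff)
  moreover have "emb_Cinf (Poly_Mapping.single m k) \<in> sub_Z"
    unfolding sub_Z_def by (rule generate.incl) (auto simp: lie_exp_ad_Iw)
  then have "emb_Cinf f \<otimes>\<^bsub>Aut_W\<^esub> emb_Cinf (Poly_Mapping.single m k) \<in> sub_Z"
    using update unfolding sub_Z_def by (intro generate.eng)
  ultimately show ?case
    by (simp only: emb_Cinf_add Aut_W_simps)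
qed

lemma range_emb_Cinf: "range emb_Cinf = sub_Zt"
proof
  \<comment> \<open>The whole range already lies in \<open>sub_Z\<close>, so the identity serves as
    the factor from \<open>sub_t\<close>.\<close>
  have "id \<in> sub_t" by (auto simp: sub_t_def sigma_bar_id intro: exI[of _ 0])
  then show "range emb_Cinf \<subseteq> sub_Zt"
    using emb_Cinf_in_sub_Z unfolding sub_Zt_def set_mult_def Aut_W_simps
    by (metis (mono_tags, lifting) UN_iff comp_id image_subsetI singletonI)
  have "sub_Z \<subseteq> range emb_Cinf"
    unfolding sub_Z_def
    by (rule Aut_W.generate_subgroup_incl[OF _ range_emb_Cinf_subgroup]) (auto simp: lie_exp_ad_Iw)
  then show "sub_Zt \<subseteq> range emb_Cinf"
    using sub_t_subset subgroup.m_closed[OF range_emb_Cinf_subgroup]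
    unfolding sub_Zt_def set_mult_def by blast
qed

lemma emb_Cinf_iso: "emb_Cinf \<in> iso Cinf (Aut_W\<lparr>carrier := sub_Zt\<rparr>)"
  using emb_Cinf_hom emb_Cinf_inj range_emb_Cinf
  by (auto simp: iso_def bij_betw_def hom_def Cinf_def)

text \<open>Conjugating the exponential of ad v by f gives the exponential of ad (f v), and f v
  stays in the ideal.\<close>

lemma Aut_W_normalizes_Cinf:
  assumes f: "f \<in> carrier Aut_W"
  obtains d where "f \<circ> emb_Cinf c = emb_Cinf d \<circ> f"
proof -
  obtain d where d: "f (I_elem c) = I_elem d"
    by (rule I_elem_surj[of "f (I_elem c)"]) (simp_all add: Aut_W_I_part[OF f])
  have "f \<circ> emb_Cinf c = emb_Cinf d \<circ> f"
    by (simp add: fun_eq_iff emb_Cinf_apply Aut_W_add[OF f] Aut_W_bracket[OF f] d)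
  then show thesis by (rule that)
qed

section \<open>Assembling the two semidirect products\<close>

interpretation Z2_CC: semidirect_embedding "Cstar \<times>\<times> Cstar" Z2 Aut_W emb_CC emb_Z2
proof (intro semidirect_embedding.intro semidirect_embedding_axioms.intro
    DirProd_group Cstar_group Z2_group Aut_W_group emb_CC_hom emb_CC_inj emb_Z2_hom)
  fix \<epsilon> x assume "\<epsilon> \<in> carrier Z2" "x \<in> carrier (Cstar \<times>\<times> Cstar)"
  then show "\<exists>d\<in>carrier (Cstar \<times>\<times> Cstar).
      emb_Z2 \<epsilon> \<otimes>\<^bsub>Aut_W\<^esub> emb_CC x = emb_CC d \<otimes>\<^bsub>Aut_W\<^esub> emb_Z2 \<epsilon>"
    by (intro bexI[of _ "(fst x powi \<epsilon>, snd x)"])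
      (auto simp: emb_Z2_def emb_CC_def Z2_def carrier_Cstar sigma_bar_comp)
qed

lemma emb_Z2_CC_hom: "emb_Z2_CC \<in> hom Z2_CC Aut_W"
  unfolding Z2_CC_def act_Z2_CC_def emb_Z2_CC_def by (rule Z2_CC.prod_emb_hom)

lemma Z2_CC_group: "group Z2_CC"
  unfolding Z2_CC_def act_Z2_CC_def by (rule Z2_CC.semidirect_group)

lemma carrier_Z2_CC: "carrier Z2_CC = ((- {0}) \<times> (- {0})) \<times> {1, -1}"
  by (simp add: Z2_CC_def semidirect_def carrier_Cstar Z2_def)

text \<open>The sign change is applied first, so the diagonal factor sees index \<epsilon> * n; this
  is the source of the exponent \<epsilon>.\<close>

lemma emb_Z2_CC_eq:
  assumes "((a, \<mu>), \<epsilon>) \<in> carrier Z2_CC"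
  shows "emb_Z2_CC ((a, \<mu>), \<epsilon>) = sigma_bar \<epsilon> 0 (a powi \<epsilon>) \<mu>"
  using assms by (auto simp: emb_Z2_CC_def emb_CC_def emb_Z2_def carrier_Z2_CC sigma_bar_comp)

interpretation Cinf: semidirect_embedding Cinf Z2_CC Aut_W emb_Cinf emb_Z2_CC
proof (intro semidirect_embedding.intro semidirect_embedding_axioms.intro
    Cinf_group Z2_CC_group Aut_W_group emb_Cinf_hom emb_Z2_CC_hom)
  show "inj_on emb_Cinf (carrier Cinf)"
    using emb_Cinf_inj by (simp add: Cinf_def)
  fix h c assume "h \<in> carrier Z2_CC"
  then have "emb_Z2_CC h \<in> carrier Aut_W"
    by (rule hom_in_carrier[OF emb_Z2_CC_hom])
  then obtain d where "emb_Z2_CC h \<circ> emb_Cinf c = emb_Cinf d \<circ> emb_Z2_CC h"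
    by (rule Aut_W_normalizes_Cinf)
  then show "\<exists>d\<in>carrier Cinf.
      emb_Z2_CC h \<otimes>\<^bsub>Aut_W\<^esub> emb_Cinf c = emb_Cinf d \<otimes>\<^bsub>Aut_W\<^esub> emb_Z2_CC h"
    by (auto simp: Cinf_def)
qed

lemma Cinf_prod_emb_surj:
  assumes f: "f \<in> carrier Aut_W"
  shows "f \<in> Cinf.prod_emb ` carrier (semidirect Cinf Z2_CC Cinf.act)"
proof -
  obtain \<epsilon> a \<mu> c where e: "\<epsilon> \<in> {1, -1}" and a: "a \<noteq> 0" and mu: "\<mu> \<noteq> 0"
    and fc: "f = sigma_bar \<epsilon> 0 a \<mu> \<circ> emb_Cinf c"
    using f by (rule Aut_W_decomposition)
  obtain d where d: "sigma_bar \<epsilon> 0 a \<mu> \<circ> emb_Cinf c = emb_Cinf d \<circ> sigma_bar \<epsilon> 0 a \<mu>"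
    \<comment> \<open>The decomposition has the exponential on the right, whereas
      \<open>prod_emb\<close> expects it on the left.\<close>
    using sigma_bar_Aut[OF e a mu] by (rule Aut_W_normalizes_Cinf)
  \<comment> \<open>The exponent \<epsilon> cancels the one introduced by
    \<open>emb_Z2_CC_eq\<close>.\<close>
  let ?h = "((a powi \<epsilon>, \<mu>), \<epsilon>)"
  have h: "?h \<in> carrier Z2_CC" using e a mu by (auto simp: carrier_Z2_CC)
  have "(a powi \<epsilon>) powi \<epsilon> = a" using e by auto
  then have "f = Cinf.prod_emb (d, ?h)"
    using fc d by (simp add: emb_Z2_CC_eq[OF h])
  moreover have "(d, ?h) \<in> carrier (semidirect Cinf Z2_CC Cinf.act)"
    using h by (simp add: semidirect_def Cinf_def)
  ultimately show ?thesis by (rule image_eqI)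
qed

text \<open>An exponential fixes L_1 modulo the ideal and fixes I_0, which forces all three diagonal
  parameters to be 1.\<close>

lemma emb_Cinf_eq_emb_Z2_CC:
  assumes h: "h \<in> carrier Z2_CC" and eq: "emb_Cinf c = emb_Z2_CC h"
  shows "h = \<one>\<^bsub>Z2_CC\<^esub>"
proof -
  obtain a \<mu> \<epsilon> where hh: "h = ((a, \<mu>), \<epsilon>)" by (metis surj_pair)
  with h have e: "\<epsilon> \<in> {1, -1}" and a: "a \<noteq> 0" by (auto simp: carrier_Z2_CC)
  have s: "emb_Cinf c = sigma_bar \<epsilon> 0 (a powi \<epsilon>) \<mu>"
    using h eq by (simp add: hh emb_Z2_CC_eq)
  have "L_coeff (emb_Cinf c (Lw 1)) \<epsilon> = L_coeff (sigma_bar \<epsilon> 0 (a powi \<epsilon>) \<mu> (Lw 1)) \<epsilon>"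
    and "I_coeff (emb_Cinf c (Iw 0)) 0 = I_coeff (sigma_bar \<epsilon> 0 (a powi \<epsilon>) \<mu> (Iw 0)) 0"
    by (simp_all add: s)
  then have "\<epsilon> = 1 \<and> a = 1 \<and> \<mu> = 1"
    using e a by (auto simp: coeff_emb_Cinf_Lw emb_Cinf_Iw sigma_bar_basis lookup_add)
  then show ?thesis
    by (simp add: hh Z2_CC_def semidirect_def DirProd_def Cstar_def Z2_def)
qed

theorem theorem4p5:
  shows
    "emb_Z2 \<in> iso Z2 (Aut_W\<lparr>carrier := sub_a\<rparr>)
     \<and> emb_CC \<in> iso (Cstar \<times>\<times> Cstar) (Aut_W\<lparr>carrier := sub_b\<rparr>)
     \<and> emb_Cinf \<in> iso Cinf (Aut_W\<lparr>carrier := sub_Zt\<rparr>)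
     \<and> act_Z2_CC \<in> hom Z2 (AutoGroup (Cstar \<times>\<times> Cstar))
     \<and> act_Cinf \<in> hom Z2_CC (AutoGroup Cinf)
     \<and> Aut_W \<cong> semidirect Cinf Z2_CC act_Cinf"
proof (intro conjI emb_Z2_iso emb_CC_iso emb_Cinf_iso)
  show "act_Z2_CC \<in> hom Z2 (AutoGroup (Cstar \<times>\<times> Cstar))"
    unfolding act_Z2_CC_def by (rule Z2_CC.act_hom)
  show "act_Cinf \<in> hom Z2_CC (AutoGroup Cinf)"
    unfolding act_Cinf_def by (rule Cinf.act_hom)
  have "inj_on Cinf.prod_emb (carrier (semidirect Cinf Z2_CC Cinf.act))"
    by (rule Cinf.prod_emb_inj) (rule emb_Cinf_eq_emb_Z2_CC)
  moreover have "Cinf.prod_emb ` carrier (semidirect Cinf Z2_CC Cinf.act) = carrier Aut_W"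
    using Cinf_prod_emb_surj hom_in_carrier[OF Cinf.prod_emb_hom] by blast
  ultimately have "Cinf.prod_emb \<in> iso (semidirect Cinf Z2_CC Cinf.act) Aut_W"
    using Cinf.prod_emb_hom by (simp add: iso_def bij_betw_def)
  then show "Aut_W \<cong> semidirect Cinf Z2_CC act_Cinf"
    unfolding is_iso_def act_Cinf_def using group.iso_set_sym[OF Cinf.semidirect_group] by blast
qed

end
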